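(* Under the assumptions below, suppose $\mu$ is sufficiently large. The data $(X_i,U_i,\mathcal{E}_i)$ are informative for the cooperative output regulation problem if, for every $i\in\{1,\dots,N\}$, there exists a right inverse $X_i^{+}$ of $X_i$ such that $(X_i\mathcal{D}_{11}-E_iV)X_i^{+}$ is stable and the data-driven transmission zero condition $\mathrm{rank}\begin{bmatrix}X_i\mathcal{D}_{11}-E_iV-\lambda_S X_i\\ \mathcal{E}_i-F_iV\end{bmatrix}=n_i+p$ holds for all $\lambda_S\in\sigma(S)$.
   Context: Leader–follower multi-agent system with $N$ followers. Follower $i$: $\dot x_i=A_ix_i+B_iu_i+E_iv$, $e_i=C_ix_i+D_iu_i+F_iv$ (tracking error), with $x_i\in\mathbb{R}^{n_i}$, $e_i\in\mathbb{R}^{p}$; exosystem $\dot v=Sv$, $v\in\mathbb{R}^q$. $A_i,B_i,C_i,D_i$ are unknown; $E_i,F_i,S$ are known. Distributed controller: $u_i=K_{1i}x_i+K_{2i}\eta_i$, $\dot\eta_i=S\eta_i+\mu[\sum_j a_{ij}(\eta_j-\eta_i)+a_{i0}(v-\eta_i)]$. Data: signals expanded in an orthogonal polynomial basis truncated at degree $N$; $X_i,U_i,\mathcal{E}_i,V$ are the matrices of the first $N+1$ coefficient vectors of $x_i,u_i,e_i,v$, and $\mathcal{D}_{11}$ is the leading $(N+1)\times(N+1)$ block of the basis differentiation matrix. Exact data: $X_i\mathcal{D}_{11}=A_iX_i+B_iU_i+E_iV$, $\mathcal{E}_i=C_iX_i+D_iU_i+F_iV$. The data are informative for cooperative output regulation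 if every system $(A_i,B_i,C_i,D_i)$ consistent with the data admits gains $K_{1i},K_{2i}$ and $\mu$ such that the closed-loop matrix is Hurwitz and $e(t)\to0$ (here certified via the model-based transmission-zero condition $\mathrm{rank}\begin{bmatrix}A_i-\lambda_SI&B_i\\C_i&D_i\end{bmatrix}=n_i+p$ for all consistent systems). Assumptions: $S$ has no eigenvalues with negative real part; the graph is unknown but contains a directed spanning tree rooted at the leader; nonzero Laplacian entries satisfy $\varepsilon_1\le|\mathcal{L}_{ij}|\le\varepsilon_2$. *)

theory Defs
  imports Complex_Main "Jordan_Normal_Form.DL_Rank" "Jordan_Normal_Form.Char_Poly"
begin

definition hurwitz :: "real mat \<Rightarrow> bool" where
  "hurwitz A \<longleftrightarrow> dim_row A = dim_col A \<and>
     (\<forall>z. eigenvalue (map_mat complex_of_real A) z \<longrightarrow> Re z < 0)"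

definition spec :: "real mat \<Rightarrow> complex set" where
  "spec S = {z. eigenvalue (map_mat complex_of_real S) z}"

definition vstack :: "'a::zero mat \<Rightarrow> 'a mat \<Rightarrow> 'a mat" where
  "vstack A B = mat (dim_row A + dim_row B) (dim_col A)
     (\<lambda>(r,c). if r < dim_row A then A $$ (r,c) else B $$ (r - dim_row A, c))"

fun bdiag :: "'a::zero mat list \<Rightarrow> 'a mat" where
  "bdiag [] = 0\<^sub>m 0 0"
| "bdiag (M # Ms) = four_block_mat M (0\<^sub>m (dim_row M) (dim_col (bdiag Ms)))
                      (0\<^sub>m (dim_row (bdiag Ms)) (dim_col M)) (bdiag Ms)"

definition dd_tz_mat ::
  "real mat \<Rightarrow> real mat \<Rightarrow> real mat \<Rightarrow> real mat \<Rightarrow> real mat \<Rightarrow> real mat \<Rightarrow> complex \<Rightarrow> complex mat" where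
  "dd_tz_mat X Ecal V D11 E F z =
     vstack (map_mat complex_of_real (X * D11 - E * V) - z \<cdot>\<^sub>m map_mat complex_of_real X)
            (map_mat complex_of_real (Ecal - F * V))"

definition consistent_sys ::
  "nat \<Rightarrow> nat \<Rightarrow> nat \<Rightarrow> real mat \<Rightarrow> real mat \<Rightarrow> real mat \<Rightarrow> real mat \<Rightarrow> real mat \<Rightarrow>
   real mat \<Rightarrow> real mat \<Rightarrow> real mat \<Rightarrow> real mat \<Rightarrow> real mat \<Rightarrow> real mat \<Rightarrow> bool" where
  "consistent_sys n m p X U Ecal V D11 E F A B C D \<longleftrightarrow>
     A \<in> carrier_mat n n \<and> B \<in> carrier_mat n m \<and> C \<in> carrier_mat p n \<and> D \<in> carrier_mat p m \<and>
     X * D11 = A * X + B * U + E * V \<and> Ecal = C * X + D * U + F * V"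

(* Graph: followers 0..<Nf, a i j = weight of edge j -> i (i listens to j),
   a0 i = weight of edge leader -> i.  Nodes reachable from the leader: *)
inductive leader_reach :: "nat \<Rightarrow> (nat \<Rightarrow> nat \<Rightarrow> real) \<Rightarrow> (nat \<Rightarrow> real) \<Rightarrow> nat \<Rightarrow> bool"
  for Nf a a0 where
  root: "i < Nf \<Longrightarrow> a0 i \<noteq> 0 \<Longrightarrow> leader_reach Nf a a0 i"
| step: "leader_reach Nf a a0 j \<Longrightarrow> i < Nf \<Longrightarrow> i \<noteq> j \<Longrightarrow> a i j \<noteq> 0 \<Longrightarrow> leader_reach Nf a a0 i"

definition lap_deg :: "nat \<Rightarrow> (nat \<Rightarrow> nat \<Rightarrow> real) \<Rightarrow> (nat \<Rightarrow> real) \<Rightarrow> nat \<Rightarrow> real" where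
  "lap_deg Nf a a0 i = (\<Sum>j\<in>{..<Nf} - {i}. a i j) + a0 i"

definition lapH :: "nat \<Rightarrow> (nat \<Rightarrow> nat \<Rightarrow> real) \<Rightarrow> (nat \<Rightarrow> real) \<Rightarrow> nat \<Rightarrow> nat \<Rightarrow> real" where
  "lapH Nf a a0 i j = (if i = j then lap_deg Nf a a0 i else - a i j)"

(* Admissible (unknown) graphs: nonnegative weights, a directed spanning tree
   rooted at the leader (every follower reachable from the leader), and every
   nonzero entry of the Laplacian of the leader-follower graph has absolute value
   in [eps1, eps2].  (The leader row of the Laplacian is zero.) *)
definition admissible_graph :: "nat \<Rightarrow> (nat \<Rightarrow> nat \<Rightarrow> real) \<Rightarrow> (nat \<Rightarrow> real) \<Rightarrow> real \<Rightarrow> real \<Rightarrow> bool" where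
  "admissible_graph Nf a a0 eps1 eps2 \<longleftrightarrow>
     (\<forall>i<Nf. \<forall>j<Nf. 0 \<le> a i j) \<and> (\<forall>i<Nf. 0 \<le> a0 i) \<and>
     (\<forall>i<Nf. leader_reach Nf a a0 i) \<and>
     (\<forall>i<Nf. \<forall>j<Nf. i \<noteq> j \<longrightarrow> a i j \<noteq> 0 \<longrightarrow> eps1 \<le> a i j \<and> a i j \<le> eps2) \<and>
     (\<forall>i<Nf. a0 i \<noteq> 0 \<longrightarrow> eps1 \<le> a0 i \<and> a0 i \<le> eps2) \<and>
     (\<forall>i<Nf. lap_deg Nf a a0 i \<noteq> 0 \<longrightarrow> eps1 \<le> lap_deg Nf a a0 i \<and> lap_deg Nf a a0 i \<le> eps2)"

(* I_N (x) S - mu (H (x) I_q) *)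
definition obs_mat :: "nat \<Rightarrow> nat \<Rightarrow> real mat \<Rightarrow> real \<Rightarrow> (nat \<Rightarrow> nat \<Rightarrow> real) \<Rightarrow> real mat" where
  "obs_mat Nf q S \<mu> H = mat (Nf * q) (Nf * q) (\<lambda>(r,c).
      (if r div q = c div q then S $$ (r mod q, c mod q) else 0)
      - \<mu> * H (r div q) (c div q) * (if r mod q = c mod q then 1 else 0))"

(* closed-loop matrix in the state (x_1..x_N, eta_1..eta_N) *)
definition closed_loop_mat ::
  "nat \<Rightarrow> nat \<Rightarrow> real mat \<Rightarrow> real \<Rightarrow> (nat \<Rightarrow> nat \<Rightarrow> real) \<Rightarrow> (nat \<Rightarrow> real) \<Rightarrow>
   (nat \<Rightarrow> real mat) \<Rightarrow> (nat \<Rightarrow> real mat) \<Rightarrow> (nat \<Rightarrow> real mat) \<Rightarrow> (nat \<Rightarrow> real mat) \<Rightarrow> real mat" where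
  "closed_loop_mat Nf q S \<mu> a a0 A B K1 K2 =
     (let Dx = bdiag (map (\<lambda>i. A i + B i * K1 i) [0..<Nf]);
          Dxe = bdiag (map (\<lambda>i. B i * K2 i) [0..<Nf])
      in four_block_mat Dx Dxe (0\<^sub>m (Nf * q) (dim_col Dx)) (obs_mat Nf q S \<mu> (lapH Nf a a0)))"

definition vderiv :: "(real \<Rightarrow> real vec) \<Rightarrow> nat \<Rightarrow> (real \<Rightarrow> real vec) \<Rightarrow> bool" where
  "vderiv x n x' \<longleftrightarrow> (\<forall>t. dim_vec (x t) = n \<and>
      (\<forall>k<n. ((\<lambda>s. x s $ k) has_real_derivative (x' t $ k)) (at t)))"

definition ctrl :: "real mat \<Rightarrow> real mat \<Rightarrow> real vec \<Rightarrow> real vec \<Rightarrow> real vec" where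
  "ctrl K1 K2 x \<eta> = K1 *\<^sub>v x + K2 *\<^sub>v \<eta>"

definition cl_solution ::
  "nat \<Rightarrow> (nat \<Rightarrow> nat) \<Rightarrow> nat \<Rightarrow> real mat \<Rightarrow> real \<Rightarrow> (nat \<Rightarrow> nat \<Rightarrow> real) \<Rightarrow> (nat \<Rightarrow> real) \<Rightarrow>
   (nat \<Rightarrow> real mat) \<Rightarrow> (nat \<Rightarrow> real mat) \<Rightarrow> (nat \<Rightarrow> real mat) \<Rightarrow> (nat \<Rightarrow> real mat) \<Rightarrow> (nat \<Rightarrow> real mat) \<Rightarrow>
   (real \<Rightarrow> real vec) \<Rightarrow> (nat \<Rightarrow> real \<Rightarrow> real vec) \<Rightarrow> (nat \<Rightarrow> real \<Rightarrow> real vec) \<Rightarrow> bool" where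
  "cl_solution Nf n q S \<mu> a a0 A B E K1 K2 v x \<eta> \<longleftrightarrow>
     vderiv v q (\<lambda>t. S *\<^sub>v v t) \<and>
     (\<forall>i<Nf. vderiv (x i) (n i)
               (\<lambda>t. A i *\<^sub>v x i t + B i *\<^sub>v ctrl (K1 i) (K2 i) (x i t) (\<eta> i t) + E i *\<^sub>v v t)) \<and>
     (\<forall>i<Nf. vderiv (\<eta> i) q
               (\<lambda>t. vec q (\<lambda>k. (S *\<^sub>v \<eta> i t) $ k +
                   \<mu> * ((\<Sum>j<Nf. a i j * (\<eta> j t $ k - \<eta> i t $ k)) + a0 i * (v t $ k - \<eta> i t $ k)))))"

definition track_err ::
  "real mat \<Rightarrow> real mat \<Rightarrow> real mat \<Rightarrow> real mat \<Rightarrow> real mat \<Rightarrow> real vec \<Rightarrow> real vec \<Rightarrow> real vec \<Rightarrow> real vec" where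
  "track_err C D F K1 K2 x \<eta> v = C *\<^sub>v x + D *\<^sub>v ctrl K1 K2 x \<eta> + F *\<^sub>v v"

definition coop_informative ::
  "nat \<Rightarrow> (nat \<Rightarrow> nat) \<Rightarrow> (nat \<Rightarrow> nat) \<Rightarrow> nat \<Rightarrow> nat \<Rightarrow>
   (nat \<Rightarrow> real mat) \<Rightarrow> (nat \<Rightarrow> real mat) \<Rightarrow> (nat \<Rightarrow> real mat) \<Rightarrow> real mat \<Rightarrow> real mat \<Rightarrow>
   (nat \<Rightarrow> real mat) \<Rightarrow> (nat \<Rightarrow> real mat) \<Rightarrow> real mat \<Rightarrow> real \<Rightarrow> real \<Rightarrow> real \<Rightarrow> bool" where
  "coop_informative Nf n m p q X U Ecal V D11 E F S eps1 eps2 \<mu> \<longleftrightarrow>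
     (\<forall>a a0 A B C D.
        admissible_graph Nf a a0 eps1 eps2 \<and>
        (\<forall>i<Nf. consistent_sys (n i) (m i) p (X i) (U i) (Ecal i) V D11 (E i) (F i) (A i) (B i) (C i) (D i))
        \<longrightarrow>
        (\<exists>K1 K2. (\<forall>i<Nf. K1 i \<in> carrier_mat (m i) (n i) \<and> K2 i \<in> carrier_mat (m i) q) \<and>
           hurwitz (closed_loop_mat Nf q S \<mu> a a0 A B K1 K2) \<and>
           (\<forall>v x \<eta>. cl_solution Nf n q S \<mu> a a0 A B E K1 K2 v x \<eta> \<longrightarrow>
              (\<forall>i<Nf. \<forall>k<p. ((\<lambda>t. track_err (C i) (D i) (F i) (K1 i) (K2 i) (x i t) (\<eta> i t) (v t) $ k)
                                 \<longlongrightarrow> 0) at_top))))"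

end

theory Submission
  imports Defs "Jordan_Normal_Form.Schur_Decomposition"
begin

text \<open>Every consistent system satisfies \<open>X D11 - E V = A X + B U\<close> and \<open>Ecal - F V = C X + D U\<close>.
  Hence \<open>K1 = U X\<^sup>+\<close> gives \<open>A + B K1 = (X D11 - E V) X\<^sup>+\<close>, which is stable. By the rank condition
  the generalized Sylvester equation \<open>(X D11 - E V) Y + E = X Y S\<close>, \<open>(Ecal - F V) Y + F = 0\<close> has a
  solution \<open>Y\<close>: with \<open>S\<close> in Schur form it is solved column by column. Then \<open>\<Pi> = X Y\<close> and \<open>\<Gamma> = U Y\<close>
  solve the regulator equations of all consistent systems at once, and \<open>K2 = \<Gamma> - K1 \<Pi>\<close>.

  The observer matrix has the eigenvalues \<open>\<lambda>\<^sub>S - \<mu> \<lambda>\<^sub>H\<close>, and the real parts of the eigenvalues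
  \<open>\<lambda>\<^sub>H\<close> of the grounded Laplacian \<open>H\<close> are bounded below uniformly over all admissible graphs: a
  positive vector \<open>w\<close> with \<open>H w \<ge> c w\<close>, built along a spanning tree, gives the bound \<open>c\<close>
  by a Gershgorin argument for the rescaled matrix. Finally, the errors \<open>\<eta> - v\<close> and \<open>x - \<Pi> v\<close>
  obey a cascade of stable linear equations with vanishing forcing.\<close>

section \<open>Stable linear equations with vanishing forcing\<close>

lemma index_mult_mat_sum:
  assumes "A \<in> carrier_mat nr n" "B \<in> carrier_mat n nc" "i < nr" "j < nc"
  shows "(A * B) $$ (i, j) = (\<Sum>k<n. A $$ (i, k) * B $$ (k, j))"
  using assms by (auto simp: scalar_prod_def atLeast0LessThan intro!: sum.cong)

lemma index_mult_mat_vec_sum: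
  assumes "A \<in> carrier_mat nr n" "v \<in> carrier_vec n" "i < nr"
  shows "(A *\<^sub>v v) $ i = (\<Sum>k<n. A $$ (i, k) * v $ k)"
  using assms by (auto simp: scalar_prod_def atLeast0LessThan intro!: sum.cong)

text \<open>The later proofs work with the intertwining \<open>Q * A = B * Q\<close>: in the
  coordinates \<open>Q x\<close> a linear problem for \<open>A\<close> becomes triangular, with
  eigenvalues of \<open>A\<close> on the diagonal, and can be treated one component at a
  time.\<close>

lemma complex_schur:
  fixes A :: "complex mat"
  assumes A: "A \<in> carrier_mat n n"
  obtains B P Q where "similar_mat_wit A B P Q" "upper_triangular B" "Q * A = B * Q"
    "\<And>k. k < n \<Longrightarrow> eigenvalue A (B $$ (k, k))"
proof -
  obtain es where es: "char_poly A = (\<Prod>a\<leftarrow>es. [:- a, 1:])"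
    using char_poly_factorized[OF A] by auto
  obtain B P Q where dec: "schur_decomposition A es = (B, P, Q)"
    by (cases "schur_decomposition A es") auto
  note schur = schur_decomposition[OF A es dec]
  have B: "B \<in> carrier_mat n n"
    using schur similar_mat_witD2[OF A] by blast
  have "eigenvalue A (B $$ (k, k))" if "k < n" for k
  proof -
    have "B $$ (k, k) \<in> set es"
      using schur B that by (auto simp: diag_mat_def)
    then show ?thesis
      unfolding eigenvalue_root_char_poly[OF A] es
      by (induction es) auto
  qed
  moreover have "Q * A = B * Q"
  proof -
    have sim: "similar_mat_wit A B P Q" using schur by blast
    note wit = similar_mat_witD2[OF A sim]
    have "Q * A = Q * (P * B * Q)" using wit(3) by simp
    also have "\<dots> = (Q * P) * (B * Q)" using wit(5-7) by (simp add: assoc_mult_mat[of _ n n _ n _ n])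
    finally show ?thesis using wit by simp
  qed
  ultimately show ?thesis using schur by (intro that[of B P Q]) auto
qed

text \<open>A comparison argument: once \<open>h\<close> stays below \<open>a * e / 2\<close>, the
  excess of \<open>u\<close> over \<open>e / 2\<close> is bounded by a multiple of
  \<open>exp (- a * t)\<close>.\<close>

lemma tendsto_zero_of_deriv_le:
  fixes u u' h :: "real \<Rightarrow> real"
  assumes a: "0 < a"
    and deriv: "\<And>t. (u has_real_derivative u' t) (at t)"
    and le: "\<And>t. u' t \<le> h t - a * u t"
    and nonneg: "\<And>t. 0 \<le> u t"
    and h: "(h \<longlongrightarrow> 0) at_top"
  shows "(u \<longlongrightarrow> 0) at_top"
proof (rule tendstoI)
  fix e :: real assume e: "0 < e"
  have "eventually (\<lambda>t. h t < a * e / 2) at_top"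
    using order_tendstoD(2)[OF h, of "a * e / 2"] a e by simp
  then obtain t0 where t0: "\<And>t. t0 \<le> t \<Longrightarrow> h t < a * e / 2"
    by (auto simp: eventually_at_top_linorder)
  \<comment> \<open>The level \<open>e / 2\<close> is the equilibrium of
    \<open>u' = a * e / 2 - a * u\<close>; the integrating factor makes the distance to it
    nonincreasing after \<open>t0\<close>.\<close>
  define g where "g t = (u t - e / 2) * exp (a * t)" for t
  have g_deriv: "(g has_real_derivative exp (a * t) * (u' t + a * u t - a * e / 2)) (at t)" for t
    unfolding g_def by (auto intro!: derivative_eq_intros deriv simp: algebra_simps)
  have g_le: "g t \<le> g t0" if "t0 \<le> t" for t
  proof (rule DERIV_nonpos_imp_nonincreasing[OF that])
    fix s assume "t0 \<le> s" "s \<le> t"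
    have "u' s + a * u s - a * e / 2 \<le> 0"
      using le[of s] t0[OF \<open>t0 \<le> s\<close>] by linarith
    then show "\<exists>y. (g has_real_derivative y) (at s) \<and> y \<le> 0"
      using g_deriv[of s] by (intro exI[of _ "exp (a * s) * (u' s + a * u s - a * e / 2)"])
        (auto intro: mult_nonneg_nonpos)
  qed
  have "filterlim (\<lambda>t. - a * t) at_bot at_top"
    using a by (intro filterlim_tendsto_neg_mult_at_bot[OF tendsto_const _ filterlim_ident]) simp
  then have "((\<lambda>t. g t0 * exp (- a * t)) \<longlongrightarrow> g t0 * 0) at_top"
    by (intro tendsto_mult tendsto_const filterlim_compose[OF exp_at_bot])
  then have "eventually (\<lambda>t. g t0 * exp (- a * t) < e / 2) at_top"
    using order_tendstoD(2)[of _ "g t0 * 0" at_top "e / 2"] e by auto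
  then show "eventually (\<lambda>t. dist (u t) 0 < e) at_top"
    using eventually_ge_at_top[of t0]
  proof eventually_elim
    case (elim t)
    have "u t - e / 2 = g t * exp (- a * t)"
      by (simp add: g_def mult.assoc flip: exp_add)
    also have "\<dots> \<le> g t0 * exp (- a * t)"
      using g_le[OF elim(2)] by (intro mult_right_mono) auto
    finally show ?case using elim(1) nonneg[of t] by (simp add: dist_real_def)
  qed
qed

lemma two_mult_le_weighted_squares:
  fixes a x y :: real
  assumes "0 < a"
  shows "2 * (x * y) \<le> a * x\<^sup>2 + y\<^sup>2 / a"
proof -
  have "0 \<le> (a * x - y)\<^sup>2 / a" using assms by simp
  also have "\<dots> = a * x\<^sup>2 + y\<^sup>2 / a - 2 * (x * y)"
    using assms by (simp add: field_simps power2_eq_square)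
  finally show ?thesis by simp
qed

text \<open>With \<open>a = - Re c\<close>, the energy \<open>u = |y|^2\<close> has derivative
  \<open>- 2 a u\<close> plus twice the real inner product of \<open>y\<close> and \<open>g\<close>.
  Young's inequality spends half of the damping on this cross term and leaves
  \<open>u' \<le> |g|^2 / a - a u\<close>.\<close>

lemma forced_scalar_ode_tendsto_zero:
  fixes y g :: "real \<Rightarrow> complex"
  assumes c: "Re c < 0"
    and deriv: "\<And>t. (y has_vector_derivative c * y t + g t) (at t)"
    and g: "(g \<longlongrightarrow> 0) at_top"
  shows "(y \<longlongrightarrow> 0) at_top"
proof -
  define a where "a = - Re c"
  have a: "0 < a" using c by (simp add: a_def)
  have dRe: "((\<lambda>t. Re (y t)) has_real_derivative Re (c * y t + g t)) (at t)" for t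
    using bounded_linear.has_vector_derivative[OF bounded_linear_Re deriv]
    by (simp add: has_real_derivative_iff_has_vector_derivative)
  have dIm: "((\<lambda>t. Im (y t)) has_real_derivative Im (c * y t + g t)) (at t)" for t
    using bounded_linear.has_vector_derivative[OF bounded_linear_Im deriv]
    by (simp add: has_real_derivative_iff_has_vector_derivative)
  define u where "u t = (Re (y t))\<^sup>2 + (Im (y t))\<^sup>2" for t
  define h where "h t = ((Re (g t))\<^sup>2 + (Im (g t))\<^sup>2) / a" for t
  have "(u \<longlongrightarrow> 0) at_top"
  proof (rule tendsto_zero_of_deriv_le[OF a])
    show "(u has_real_derivative
        2 * Re (y t) * Re (c * y t + g t) + 2 * Im (y t) * Im (c * y t + g t)) (at t)" for t
      using DERIV_add[OF DERIV_power[OF dRe[of t], of 2] DERIV_power[OF dIm[of t], of 2]]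
      by (simp add: u_def [abs_def] algebra_simps)
    show "2 * Re (y t) * Re (c * y t + g t) + 2 * Im (y t) * Im (c * y t + g t) \<le> h t - a * u t" for t
      using two_mult_le_weighted_squares[OF a, of "Re (y t)" "Re (g t)"]
        two_mult_le_weighted_squares[OF a, of "Im (y t)" "Im (g t)"]
      by (simp add: u_def h_def a_def algebra_simps power2_eq_square add_divide_distrib)
    show "0 \<le> u t" for t by (simp add: u_def)
    have "((\<lambda>t. ((Re (g t))\<^sup>2 + (Im (g t))\<^sup>2) / a) \<longlongrightarrow> ((Re 0)\<^sup>2 + (Im 0)\<^sup>2) / a) at_top"
      using a by (intro tendsto_intros g) auto
    then show "(h \<longlongrightarrow> 0) at_top" by (simp add: h_def [abs_def])
  qed
  then have "((\<lambda>t. sqrt (u t)) \<longlongrightarrow> sqrt 0) at_top" by (rule tendsto_real_sqrt)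
  then have "((\<lambda>t. norm (y t)) \<longlongrightarrow> 0) at_top" by (simp add: u_def cmod_def)
  then show ?thesis by (rule tendsto_norm_zero_cancel)
qed

text \<open>In Schur coordinates \<open>y = Q x\<close> the last component solves a stable scalar
  equation with vanishing forcing. Each earlier component does the same once the later ones, which
  tend to 0, are counted as forcing.\<close>

lemma hurwitz_forced_ode_tendsto_zero:
  fixes x g :: "real \<Rightarrow> nat \<Rightarrow> real"
  assumes A: "A \<in> carrier_mat n n" and hurwitz: "hurwitz A"
    and deriv: "\<And>t k. k < n \<Longrightarrow>
      ((\<lambda>s. x s k) has_real_derivative (\<Sum>j<n. A $$ (k, j) * x t j) + g t k) (at t)"
    and g: "\<And>k. k < n \<Longrightarrow> ((\<lambda>t. g t k) \<longlongrightarrow> 0) at_top"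
    and k: "k < n"
  shows "((\<lambda>t. x t k) \<longlongrightarrow> 0) at_top"
proof -
  let ?A = "map_mat complex_of_real A"
  have Ac: "?A \<in> carrier_mat n n" using A by simp
  obtain B P Q where sim: "similar_mat_wit ?A B P Q" and ut: "upper_triangular B"
    and QA: "Q * ?A = B * Q" and ev: "\<And>k. k < n \<Longrightarrow> eigenvalue ?A (B $$ (k, k))"
    using complex_schur[OF Ac] by blast
  note wit = similar_mat_witD2[OF Ac sim]
  define y where "y t k = (\<Sum>j<n. Q $$ (k, j) * complex_of_real (x t j))" for t k
  define f where "f t k = (\<Sum>j<n. Q $$ (k, j) * complex_of_real (g t j))" for t k
  have y_deriv: "((\<lambda>s. y s k) has_vector_derivative (\<Sum>j<n. B $$ (k, j) * y t j) + f t k) (at t)"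
    if k: "k < n" for t k
  proof -
    have "((\<lambda>s. y s k) has_vector_derivative (\<Sum>j<n. Q $$ (k, j) *
        complex_of_real ((\<Sum>l<n. A $$ (j, l) * x t l) + g t j))) (at t)"
      unfolding y_def
      by (intro has_vector_derivative_sum has_vector_derivative_mult_right
          has_vector_derivative_of_real) (auto intro: deriv)
    also have "(\<Sum>j<n. Q $$ (k, j) * complex_of_real ((\<Sum>l<n. A $$ (j, l) * x t l) + g t j))
       = (\<Sum>l<n. (\<Sum>j<n. Q $$ (k, j) * ?A $$ (j, l)) * complex_of_real (x t l)) + f t k"
      using A unfolding f_def
      by (simp add: algebra_simps sum.distrib sum_distrib_left sum_distrib_right)
        (rule sum.swap)
    also have "(\<Sum>l<n. (\<Sum>j<n. Q $$ (k, j) * ?A $$ (j, l)) * complex_of_real (x t l))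
       = (\<Sum>l<n. (Q * ?A) $$ (k, l) * complex_of_real (x t l))"
      using index_mult_mat_sum[OF wit(7) Ac k] by simp
    also have "\<dots> = (\<Sum>l<n. (\<Sum>j<n. B $$ (k, j) * Q $$ (j, l)) * complex_of_real (x t l))"
      unfolding QA using index_mult_mat_sum[OF wit(5) wit(7) k] by simp
    also have "\<dots> = (\<Sum>j<n. B $$ (k, j) * y t j)"
      unfolding y_def
      by (simp add: algebra_simps sum_distrib_left sum_distrib_right) (rule sum.swap)
    finally show ?thesis .
  qed
  have f_lim: "((\<lambda>t. f t k) \<longlongrightarrow> 0) at_top" for k
    unfolding f_def by (intro tendsto_null_sum tendsto_mult_right_zero)
      (use g tendsto_of_real[where 'a = complex] in \<open>force\<close>)
  \<comment> \<open>The index \<open>n - Suc d\<close> turns strong induction on \<open>d\<close>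
    into a descent from the last component, since row \<open>k\<close> of the triangular system
    involves only components from \<open>k\<close> on.\<close>
  have y_lim: "((\<lambda>t. y t (n - Suc d)) \<longlongrightarrow> 0) at_top" if "d < n" for d
    using that
  proof (induction d rule: less_induct)
    case (less d)
    let ?k = "n - Suc d"
    have k: "?k < n" using less.prems by simp
    have later: "((\<lambda>t. y t j) \<longlongrightarrow> 0) at_top" if "?k < j" "j < n" for j
      using less.IH[of "n - Suc j"] that by simp
    have "((\<lambda>t. (\<Sum>j\<in>{?k<..<n}. B $$ (?k, j) * y t j) + f t ?k) \<longlongrightarrow> 0) at_top"
      by (intro tendsto_add_zero f_lim tendsto_null_sum tendsto_mult_right_zero) (auto intro: later)
    moreover have "(\<Sum>j<n. B $$ (?k, j) * y t j) =
        B $$ (?k, ?k) * y t ?k + (\<Sum>j\<in>{?k<..<n}. B $$ (?k, j) * y t j)" for t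
    proof -
      have "(\<Sum>j<n. B $$ (?k, j) * y t j) = (\<Sum>j\<in>{?k..<n}. B $$ (?k, j) * y t j)"
        using ut wit(5) k by (intro sum.mono_neutral_right) (auto simp: upper_triangularD)
      also have "{?k..<n} = insert ?k {?k<..<n}" using k by auto
      finally show ?thesis by simp
    qed
    moreover have "Re (B $$ (?k, ?k)) < 0" using ev[OF k] hurwitz by (simp add: hurwitz_def)
    ultimately show ?case
      using y_deriv[OF k] forced_scalar_ode_tendsto_zero[of "B $$ (?k, ?k)" "\<lambda>t. y t ?k"
          "\<lambda>t. (\<Sum>j\<in>{?k<..<n}. B $$ (?k, j) * y t j) + f t ?k"]
      by (simp only: add.assoc)
  qed
  have y_lim: "((\<lambda>t. y t j) \<longlongrightarrow> 0) at_top" if "j < n" for j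
    using y_lim[of "n - Suc j"] that by simp
  have x_eq: "complex_of_real (x t k) = (\<Sum>j<n. P $$ (k, j) * y t j)" for t
  proof -
    have "(\<Sum>j<n. P $$ (k, j) * y t j)
        = (\<Sum>l<n. (\<Sum>j<n. P $$ (k, j) * Q $$ (j, l)) * complex_of_real (x t l))"
      unfolding y_def
      by (simp add: algebra_simps sum_distrib_left sum_distrib_right) (rule sum.swap)
    also have "\<dots> = (\<Sum>l<n. (P * Q) $$ (k, l) * complex_of_real (x t l))"
      using index_mult_mat_sum[OF wit(6) wit(7) k] by simp
    also have "\<dots> = (\<Sum>l<n. if l = k then complex_of_real (x t l) else 0)"
      unfolding wit(1) using k by (intro sum.cong) auto
    finally show ?thesis using k by simp
  qed
  have "((\<lambda>t. \<Sum>j<n. P $$ (k, j) * y t j) \<longlongrightarrow> 0) at_top"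
    by (intro tendsto_null_sum tendsto_mult_right_zero) (auto intro: y_lim)
  then have "((\<lambda>t. Re (complex_of_real (x t k))) \<longlongrightarrow> Re 0) at_top"
    unfolding x_eq by (rule tendsto_Re)
  then show ?thesis by simp
qed

section \<open>The distributed observer\<close>

text \<open>The set \<open>R\<close> grows by one follower at a time, and the follower added to a
  set of size \<open>k\<close> gets rank \<open>Suc k\<close>. It then ranks above all its
  predecessors, while ranks given earlier never change. Rank 0 is left for the leader.\<close>

lemma leader_rank_partial:
  assumes reach: "\<forall>i<Nf. leader_reach Nf a a0 i" and k: "k \<le> Nf"
  shows "\<exists>R l. R \<subseteq> {..<Nf} \<and> card R = k \<and>
    (\<forall>i\<in>R. l i \<noteq> 0 \<and> l i \<le> k \<and> (a0 i \<noteq> 0 \<or> (\<exists>j\<in>R. j \<noteq> i \<and> a i j \<noteq> 0 \<and> l j < l i)))"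
  using k
proof (induction k)
  case 0
  then show ?case by (intro exI[of _ "{}"]) auto
next
  case (Suc k)
  then obtain R and l :: "nat \<Rightarrow> nat" where R: "R \<subseteq> {..<Nf}" "card R = k"
    and l: "\<And>i. i \<in> R \<Longrightarrow> l i \<noteq> 0 \<and> l i \<le> k \<and>
      (a0 i \<noteq> 0 \<or> (\<exists>j\<in>R. j \<noteq> i \<and> a i j \<noteq> 0 \<and> l j < l i))"
    by (meson Suc_leD)
  \<comment> \<open>Otherwise \<open>R\<close> would be closed under both rules of
    \<open>leader_reach\<close>, hence contain all followers, although it has only
    \<open>k < Nf\<close> elements.\<close>
  have "\<exists>i<Nf. i \<notin> R \<and> (a0 i \<noteq> 0 \<or> (\<exists>j\<in>R. a i j \<noteq> 0))"
  proof (rule ccontr)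
    assume neg: "\<not> ?thesis"
    have "leader_reach Nf a a0 i \<Longrightarrow> i \<in> R" for i
      by (induction rule: leader_reach.induct) (use neg in auto)
    with reach have "{..<Nf} \<subseteq> R" by auto
    then have "card {..<Nf} \<le> card R"
      using R(1) finite_subset by (intro card_mono) auto
    with R(2) Suc.prems show False by simp
  qed
  then obtain i where i: "i < Nf" "i \<notin> R" "a0 i \<noteq> 0 \<or> (\<exists>j\<in>R. a i j \<noteq> 0)" by auto
  have fin: "finite R" using R(1) finite_subset by auto
  have "(l(i := Suc k)) r \<noteq> 0 \<and> (l(i := Suc k)) r \<le> Suc k \<and>
      (a0 r \<noteq> 0 \<or> (\<exists>j\<in>insert i R. j \<noteq> r \<and> a r j \<noteq> 0 \<and> (l(i := Suc k)) j < (l(i := Suc k)) r))"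
    if "r \<in> insert i R" for r
  proof (cases "r = i")
    case True
    moreover have "\<exists>j\<in>insert i R. j \<noteq> i \<and> a i j \<noteq> 0 \<and> (l(i := Suc k)) j < Suc k" if z0: "a0 i = 0"
    proof -
      obtain j where "j \<in> R" "a i j \<noteq> 0" using i(3) z0 by auto
      with i(2) l[of j] show ?thesis by (intro bexI[of _ j]) auto
    qed
    ultimately show ?thesis by auto
  next
    case False
    with that have r: "r \<in> R" by simp
    have "a0 r \<noteq> 0 \<or> (\<exists>j\<in>insert i R. j \<noteq> r \<and> a r j \<noteq> 0 \<and> (l(i := Suc k)) j < l r)"
    proof (cases "a0 r = 0")
      case True
      then obtain j where "j \<in> R" "j \<noteq> r" "a r j \<noteq> 0" "l j < l r" using l[OF r] by auto
      with i(2) show ?thesis by (intro disjI2 bexI[of _ j]) auto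
    qed simp
    then show ?thesis using l[OF r] False by simp
  qed
  then show ?case
    using i R fin
    by (intro exI[of _ "insert i R"] exI[of _ "l(i := Suc k)"]) auto
qed

lemma leader_rank:
  assumes reach: "\<forall>i<Nf. leader_reach Nf a a0 i"
  obtains l :: "nat \<Rightarrow> nat" where
    "\<And>i. i < Nf \<Longrightarrow> l i \<noteq> 0 \<and> l i \<le> Nf \<and>
      (a0 i \<noteq> 0 \<or> (\<exists>j<Nf. j \<noteq> i \<and> a i j \<noteq> 0 \<and> l j < l i))"
proof -
  obtain R and l :: "nat \<Rightarrow> nat" where R: "R \<subseteq> {..<Nf}" "card R = Nf"
    and l: "\<And>i. i \<in> R \<Longrightarrow> l i \<noteq> 0 \<and> l i \<le> Nf \<and>
      (a0 i \<noteq> 0 \<or> (\<exists>j\<in>R. j \<noteq> i \<and> a i j \<noteq> 0 \<and> l j < l i))"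
    using leader_rank_partial[OF reach order_refl] by blast
  have "R = {..<Nf}" using R by (intro card_subset_eq) auto
  with l show ?thesis by (intro that[of l]) auto
qed

text \<open>The ratio \<open>d\<close> of a geometric sequence, chosen so that
  \<open>d * (eps1 + eps2) = eps1 / 2\<close>.\<close>

definition lap_decay :: "real \<Rightarrow> real \<Rightarrow> real" where
  "lap_decay eps1 eps2 = eps1 / (2 * (eps1 + eps2))"

text \<open>The spectral bound for the grounded Laplacian. It depends on the graph only through the
  number of followers and the weight bounds, which permits one coupling gain for all admissible
  graphs.\<close>

definition lap_gap :: "nat \<Rightarrow> real \<Rightarrow> real \<Rightarrow> real" where
  "lap_gap Nf eps1 eps2 = eps1 / 2 * lap_decay eps1 eps2 ^ Nf"

lemma lap_gap_pos:
  assumes "0 < eps1" "eps1 \<le> eps2"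
  shows "0 < lap_gap Nf eps1 eps2"
  using assms by (auto simp: lap_gap_def lap_decay_def)

text \<open>The weights grow with the rank of a follower in a spanning tree, geometrically slowly enough
  that one edge from a lower rank outweighs all edges from higher ranks.\<close>

lemma admissible_graph_supersolution:
  assumes adm: "admissible_graph Nf a a0 eps1 eps2" and eps: "0 < eps1" "eps1 \<le> eps2"
  obtains w :: "nat \<Rightarrow> real" where "\<And>i. i < Nf \<Longrightarrow> 0 < w i"
    "\<And>i. i < Nf \<Longrightarrow>
      (\<Sum>j\<in>{..<Nf} - {i}. a i j * w j) \<le> (lap_deg Nf a a0 i - lap_gap Nf eps1 eps2) * w i"
proof -
  let ?c = "lap_gap Nf eps1 eps2"
  define d where "d = lap_decay eps1 eps2"
  have d: "0 < d" "d < 1" using eps by (auto simp: d_def lap_decay_def)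
  have d_eq: "d * (eps1 + eps2) = eps1 / 2" using eps by (simp add: d_def lap_decay_def field_simps)
  obtain l :: "nat \<Rightarrow> nat" where l: "\<And>i. i < Nf \<Longrightarrow> l i \<noteq> 0 \<and> l i \<le> Nf \<and>
      (a0 i \<noteq> 0 \<or> (\<exists>j<Nf. j \<noteq> i \<and> a i j \<noteq> 0 \<and> l j < l i))"
    using leader_rank[of Nf a a0] adm unfolding admissible_graph_def by metis
  \<comment> \<open>The leader, with rank 0, would get weight \<open>1 - d ^ 0 = 0\<close>. An edge
    from the leader can thus be treated like an edge from a follower of weight 0.\<close>
  define w where "w i = 1 - d ^ l i" for i
  have w_pos: "0 < w i" if "i < Nf" for i
    using l[OF that] d by (auto simp: w_def power_less_one_iff)
  have "(\<Sum>j\<in>{..<Nf} - {i}. a i j * w j) \<le> (lap_deg Nf a a0 i - ?c) * w i" if i: "i < Nf" for i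
  proof -
    let ?I = "{..<Nf} - {i}"
    have a_nonneg: "0 \<le> a i j" if "j < Nf" for j using adm i that by (simp add: admissible_graph_def)
    have a0_nonneg: "0 \<le> a0 i" using adm i by (simp add: admissible_graph_def)
    obtain k where k: "l i = Suc k" using l[OF i] by (cases "l i") auto
    have "lap_deg Nf a a0 i \<noteq> 0 \<longrightarrow> lap_deg Nf a a0 i \<le> eps2"
      using adm i unfolding admissible_graph_def by blast
    then have deg: "lap_deg Nf a a0 i \<le> eps2" using eps by (cases "lap_deg Nf a a0 i = 0") auto
    \<comment> \<open>All weights are at most 1, so no edge can contribute more than
      \<open>d ^ l i\<close>; an edge from a lower rank contributes at most a strictly negative
      amount, which is larger in size by a factor of order \<open>1 / d\<close>.\<close>
    have up: "w j - w i \<le> d ^ l i" for j using d by (simp add: w_def)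
    have drop: "w j - w i \<le> - (d ^ k * (1 - d))" if "l j \<le> k" for j
      using power_decreasing[OF that, of d] d k by (simp add: w_def algebra_simps)
    have a0_drop: "0 - w i \<le> - (d ^ k * (1 - d))"
      using power_le_one[of d k] d k by (simp add: w_def algebra_simps)
    \<comment> \<open>The left side is the weighted neighbour sum minus
      \<open>lap_deg * w i\<close>, written as a sum over incoming edges. One edge from a lower
      rank, of weight at least \<open>eps1\<close>, gives the negative term; the other edges weigh
      at most \<open>eps2\<close> in total.\<close>
    have key: "(\<Sum>j\<in>?I. a i j * (w j - w i)) + a0 i * (0 - w i)
        \<le> eps2 * d ^ l i - eps1 * (d ^ k * (1 - d))"
    proof (cases "a0 i = 0")
      case False
      then have e1: "eps1 \<le> a0 i" using adm i by (simp add: admissible_graph_def)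
      have "(\<Sum>j\<in>?I. a i j * (w j - w i)) \<le> (\<Sum>j\<in>?I. a i j * d ^ l i)"
        using a_nonneg up by (intro sum_mono mult_left_mono) auto
      also have "\<dots> \<le> eps2 * d ^ l i"
        using deg a0_nonneg d unfolding sum_distrib_right[symmetric] lap_deg_def
        by (intro mult_right_mono) auto
      moreover have "a0 i * (0 - w i) \<le> a0 i * (- (d ^ k * (1 - d)))"
        using a0_drop a0_nonneg by (intro mult_left_mono)
      moreover have "eps1 * (d ^ k * (1 - d)) \<le> a0 i * (d ^ k * (1 - d))"
        using e1 d by (intro mult_right_mono) auto
      ultimately show ?thesis by simp
    next
      case True
      then obtain j where j: "j < Nf" "j \<noteq> i" "a i j \<noteq> 0" "l j \<le> k"
        using l[OF i] k by auto
      then have e1: "eps1 \<le> a i j" using adm i by (simp add: admissible_graph_def)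
      have "(\<Sum>j\<in>?I. a i j * (w j - w i)) =
          a i j * (w j - w i) + (\<Sum>j\<in>?I - {j}. a i j * (w j - w i))"
        using j by (intro sum.remove) auto
      also have "(\<Sum>j\<in>?I - {j}. a i j * (w j - w i)) \<le> (\<Sum>j\<in>?I - {j}. a i j * d ^ l i)"
        using a_nonneg up by (intro sum_mono mult_left_mono) auto
      also have "\<dots> \<le> (\<Sum>j\<in>?I. a i j * d ^ l i)"
        using a_nonneg d by (intro sum_mono2) auto
      also have "\<dots> \<le> eps2 * d ^ l i"
        using deg a0_nonneg d unfolding sum_distrib_right[symmetric] lap_deg_def
        by (intro mult_right_mono) auto
      also have "a i j * (w j - w i) \<le> a i j * (- (d ^ k * (1 - d)))"
        using drop[OF j(4)] a_nonneg[OF j(1)] by (intro mult_left_mono)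
      also have "\<dots> \<le> - (eps1 * (d ^ k * (1 - d)))"
        using mult_right_mono[OF e1, of "d ^ k * (1 - d)"] d by simp
      finally show ?thesis using True by simp
    qed
    \<comment> \<open>Here \<open>l i = Suc k\<close>, so the choice of \<open>d\<close> leaves
      \<open>- (eps1 / 2) * d ^ k\<close>. Ranks are at most \<open>Nf\<close>, so this is at most
      minus the gap, and \<open>w i \<le> 1\<close> allows the factor \<open>w i\<close>.\<close>
    have "eps2 * d ^ l i - eps1 * (d ^ k * (1 - d)) = d ^ k * (d * (eps1 + eps2) - eps1)"
      by (simp add: k algebra_simps)
    also have "\<dots> = - (eps1 / 2 * d ^ k)" by (simp add: d_eq)
    also have "\<dots> \<le> - ?c"
      using power_decreasing[of k Nf d] l[OF i] k d eps by (simp add: lap_gap_def d_def)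
    also have "\<dots> \<le> - ?c * w i"
      using mult_left_le[of "w i" ?c] lap_gap_pos[OF eps, of Nf] d by (simp add: w_def)
    finally have "(\<Sum>j\<in>?I. a i j * (w j - w i)) + a0 i * (0 - w i) \<le> - ?c * w i"
      using key by linarith
    then show ?thesis
      by (simp add: lap_deg_def algebra_simps sum_subtractf sum_distrib_left)
  qed
  with w_pos show ?thesis by (intro that[of w]) auto
qed

text \<open>Gershgorin's argument for the Laplacian rescaled by the weights \<open>w\<close>: at a
  row \<open>i\<close> maximizing \<open>norm (y i) / w i\<close>, the eigenvalue lies in the disc
  with centre \<open>lap_deg i\<close> and radius \<open>lap_deg i\<close> minus the gap. The
  leftmost point of that disc is the gap.\<close>

lemma lapH_eigenvalue_Re_ge:
  fixes y :: "nat \<Rightarrow> complex"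
  assumes adm: "admissible_graph Nf a a0 eps1 eps2" and eps: "0 < eps1" "eps1 \<le> eps2"
    and ev: "\<And>i. i < Nf \<Longrightarrow> (\<Sum>j<Nf. complex_of_real (lapH Nf a a0 i j) * y j) = z * y i"
    and nz: "r < Nf" "y r \<noteq> 0"
  shows "lap_gap Nf eps1 eps2 \<le> Re z"
proof -
  let ?c = "lap_gap Nf eps1 eps2"
  obtain w :: "nat \<Rightarrow> real" where w: "\<And>i. i < Nf \<Longrightarrow> 0 < w i"
    and super: "\<And>i. i < Nf \<Longrightarrow>
      (\<Sum>j\<in>{..<Nf} - {i}. a i j * w j) \<le> (lap_deg Nf a a0 i - ?c) * w i"
    using admissible_graph_supersolution[OF adm eps] by blast
  define M where "M = Max ((\<lambda>j. norm (y j) / w j) ` {..<Nf})"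
  have "M \<in> (\<lambda>j. norm (y j) / w j) ` {..<Nf}"
    unfolding M_def using nz by (intro Max_in) auto
  then obtain i where i: "i < Nf" and Mi: "norm (y i) / w i = M" by auto
  have le_M: "norm (y j) \<le> M * w j" if "j < Nf" for j
  proof -
    have "norm (y j) / w j \<le> M" unfolding M_def using that by (intro Max_ge) auto
    then show ?thesis using w[OF that] by (simp add: field_simps)
  qed
  have "0 < norm (y r)" using nz by simp
  then have M: "0 < M" using le_M[OF nz(1)] w[OF nz(1)] by (smt (verit) mult_nonpos_nonneg)
  have yi: "norm (y i) = M * w i" using Mi w[OF i] by (simp add: field_simps)
  have a_nonneg: "0 \<le> a i j" if "j < Nf" for j using adm i that by (simp add: admissible_graph_def)
  let ?d = "lap_deg Nf a a0 i"
  have "z * y i = complex_of_real ?d * y i - (\<Sum>j\<in>{..<Nf} - {i}. complex_of_real (a i j) * y j)"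
    unfolding ev[OF i, symmetric] using i
    by (subst sum.remove[of _ i]) (auto simp: lapH_def sum_negf[symmetric] intro!: sum.cong)
  then have "(complex_of_real ?d - z) * y i = (\<Sum>j\<in>{..<Nf} - {i}. complex_of_real (a i j) * y j)"
    by (simp add: algebra_simps)
  then have "norm (complex_of_real ?d - z) * norm (y i)
      = norm (\<Sum>j\<in>{..<Nf} - {i}. complex_of_real (a i j) * y j)"
    by (metis norm_mult)
  also have "\<dots> \<le> (\<Sum>j\<in>{..<Nf} - {i}. a i j * norm (y j))"
    using a_nonneg by (intro order.trans[OF norm_sum] sum_mono) (simp add: norm_mult)
  also have "\<dots> \<le> (\<Sum>j\<in>{..<Nf} - {i}. a i j * (M * w j))"
    using a_nonneg le_M by (intro sum_mono mult_left_mono) auto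
  also have "\<dots> = M * (\<Sum>j\<in>{..<Nf} - {i}. a i j * w j)"
    by (simp add: sum_distrib_left algebra_simps)
  also have "\<dots> \<le> M * ((?d - ?c) * w i)"
    using super[OF i] M by (intro mult_left_mono) auto
  finally have "norm (complex_of_real ?d - z) * (M * w i) \<le> (?d - ?c) * (M * w i)"
    by (simp add: yi algebra_simps)
  then have "norm (complex_of_real ?d - z) \<le> ?d - ?c"
    using M w[OF i] by simp
  moreover have "?d - Re z \<le> norm (complex_of_real ?d - z)"
    using complex_Re_le_cmod[of "complex_of_real ?d - z"] by simp
  ultimately show ?thesis by simp
qed

section \<open>The Kronecker structure of the observer matrix\<close>

lemma sum_lessThan_mult:
  fixes f :: "nat \<Rightarrow> 'a::comm_monoid_add"
  shows "(\<Sum>s<n * q. f s) = (\<Sum>j<n. \<Sum>l<q. f (j * q + l))"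
proof -
  have "(\<Sum>s=j * q..<j * q + q. f s) = (\<Sum>l<q. f (j * q + l))" for j
    using sum.shift_bounds_nat_ivl[of f 0 "j * q" q] by (simp add: add.commute atLeast0LessThan)
  then show ?thesis by (simp flip: sum.nat_group)
qed

lemma block_index_less:
  fixes i k q n :: nat
  assumes "i < n" "k < q"
  shows "i * q + k < n * q"
proof -
  have "i * q + k < Suc i * q" using assms by simp
  also have "\<dots> \<le> n * q" using assms by (intro mult_le_mono1) simp
  finally show ?thesis .
qed

text \<open>Stated over any real field because it serves twice: for complex eigenvectors of the
  observer matrix and for the real observer error.\<close>

lemma obs_mat_row_sum:
  fixes f :: "nat \<Rightarrow> 'a::real_field"
  assumes i: "i < Nf" and k: "k < q"
  shows "(\<Sum>s<Nf * q. of_real (obs_mat Nf q S \<mu> H $$ (i * q + k, s)) * f s)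
    = (\<Sum>l<q. of_real (S $$ (k, l)) * f (i * q + l))
      - of_real \<mu> * (\<Sum>j<Nf. of_real (H i j) * f (j * q + k))"
proof -
  have entry: "obs_mat Nf q S \<mu> H $$ (i * q + k, j * q + l)
      = (if i = j then S $$ (k, l) else 0) - (if k = l then \<mu> * H i j else 0)"
    if "j \<in> {..<Nf}" "l \<in> {..<q}" for j l
    using that i k block_index_less[of i Nf k q] block_index_less[of j Nf l q]
    by (simp add: obs_mat_def)
  have "(\<Sum>s<Nf * q. of_real (obs_mat Nf q S \<mu> H $$ (i * q + k, s)) * f s)
      = (\<Sum>j<Nf. \<Sum>l<q. of_real (obs_mat Nf q S \<mu> H $$ (i * q + k, j * q + l)) * f (j * q + l))"
    by (rule sum_lessThan_mult)
  also have "\<dots> = (\<Sum>j<Nf. \<Sum>l<q. (if i = j then of_real (S $$ (k, l)) * f (j * q + l) else 0)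
      - (if k = l then of_real \<mu> * (of_real (H i j) * f (j * q + l)) else 0))"
    by (intro sum.cong refl) (simp add: entry left_diff_distrib)
  also have "\<dots> = (\<Sum>l<q. of_real (S $$ (k, l)) * f (i * q + l))
      - (\<Sum>j<Nf. of_real \<mu> * (of_real (H i j) * f (j * q + k)))"
    unfolding sum_subtractf
  proof (intro arg_cong2[of _ _ _ _ "(-)"])
    show "(\<Sum>j<Nf. \<Sum>l<q. if i = j then of_real (S $$ (k, l)) * f (j * q + l) else 0)
        = (\<Sum>l<q. of_real (S $$ (k, l)) * f (i * q + l))"
      by (subst sum.swap) (use i in simp)
    show "(\<Sum>j<Nf. \<Sum>l<q. if k = l then of_real \<mu> * (of_real (H i j) * f (j * q + l)) else 0)
        = (\<Sum>j<Nf. of_real \<mu> * (of_real (H i j) * f (j * q + k)))"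
      using k by simp
  qed
  finally show ?thesis by (simp add: sum_distrib_left)
qed

text \<open>Applying \<open>Q\<close> to every block of an eigenvector makes the \<open>S\<close>
  part triangular. The last nonzero slice \<open>k\<close> is then an eigenvector of the Laplacian
  with eigenvalue \<open>(B $$ (k, k) - z) / \<mu>\<close>, whose real part is at least the gap. The
  threshold is obtained before the graph is chosen.\<close>

lemma hurwitz_obs_mat:
  assumes S: "S \<in> carrier_mat q q"
    and eps: "0 < eps1" "eps1 \<le> eps2"
  obtains \<mu>0 where "\<And>\<mu> a a0. \<mu>0 \<le> \<mu> \<Longrightarrow> admissible_graph Nf a a0 eps1 eps2 \<Longrightarrow>
    hurwitz (obs_mat Nf q S \<mu> (lapH Nf a a0))"
proof -
  let ?S = "map_mat complex_of_real S" and ?c = "lap_gap Nf eps1 eps2"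
  have Sc: "?S \<in> carrier_mat q q" using S by simp
  obtain B P Q where sim: "similar_mat_wit ?S B P Q" and ut: "upper_triangular B"
    and QS: "Q * ?S = B * Q"
    using complex_schur[OF Sc] by metis
  note wit = similar_mat_witD2[OF Sc sim]
  have c: "0 < ?c" by (rule lap_gap_pos[OF eps])
  \<comment> \<open>A nonnegative bound for all real parts on the diagonal, meaningful also for
    \<open>q = 0\<close>. The threshold \<open>m / ?c + 1\<close> then gives both
    \<open>\<mu> > 0\<close> and \<open>m < \<mu> * ?c\<close>.\<close>
  define m where "m = (\<Sum>k<q. \<bar>Re (B $$ (k, k))\<bar>)"
  have m: "Re (B $$ (k, k)) \<le> m" if "k < q" for k
    using member_le_sum[of k "{..<q}" "\<lambda>k. \<bar>Re (B $$ (k, k))\<bar>"] that by (simp add: m_def)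
  have m0: "0 \<le> m" by (simp add: m_def sum_nonneg)
  have "Re z < 0"
    if mu: "m / ?c + 1 \<le> \<mu>" and adm: "admissible_graph Nf a a0 eps1 eps2"
      and z: "eigenvalue (map_mat complex_of_real (obs_mat Nf q S \<mu> (lapH Nf a a0))) z"
    for \<mu> a a0 z
  proof -
    let ?H = "lapH Nf a a0"
    let ?O = "map_mat complex_of_real (obs_mat Nf q S \<mu> ?H)"
    have mu_pos: "0 < \<mu>" using mu m0 c by (smt (verit) divide_nonneg_pos)
    have mu_c: "m < \<mu> * ?c"
    proof -
      have "m < (m / ?c + 1) * ?c" using c by (simp add: field_simps)
      also have "\<dots> \<le> \<mu> * ?c" using mu c by (intro mult_right_mono) auto
      finally show ?thesis .
    qed
    have O: "?O \<in> carrier_mat (Nf * q) (Nf * q)" by (simp add: obs_mat_def)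
    obtain v where v: "v \<in> carrier_vec (Nf * q)" "v \<noteq> 0\<^sub>v (Nf * q)" "?O *\<^sub>v v = z \<cdot>\<^sub>v v"
      using z O unfolding eigenvalue_def eigenvector_def by auto
    have v_eq: "(\<Sum>l<q. ?S $$ (k, l) * v $ (i * q + l))
        - \<mu> * (\<Sum>j<Nf. ?H i j * v $ (j * q + k)) = z * v $ (i * q + k)"
      if i: "i < Nf" and k: "k < q" for i k
    proof -
      let ?r = "i * q + k"
      have r: "?r < Nf * q" by (rule block_index_less[OF i k])
      have "z * v $ ?r = (?O *\<^sub>v v) $ ?r" using v r by simp
      also have "\<dots> = (\<Sum>s<Nf * q. ?O $$ (?r, s) * v $ s)"
        by (rule index_mult_mat_vec_sum[OF O v(1) r])
      also have "\<dots> = (\<Sum>s<Nf * q. of_real (obs_mat Nf q S \<mu> ?H $$ (?r, s)) * v $ s)"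
        using r by (intro sum.cong) (auto simp: obs_mat_def)
      also have "\<dots> = (\<Sum>l<q. of_real (S $$ (k, l)) * v $ (i * q + l))
          - \<mu> * (\<Sum>j<Nf. ?H i j * v $ (j * q + k))"
        by (rule obs_mat_row_sum[OF i k])
      finally show ?thesis using S k by simp
    qed
    define y where "y i k = (\<Sum>l<q. Q $$ (k, l) * v $ (i * q + l))" for i k
    have y_eq: "(\<Sum>l<q. B $$ (k, l) * y i l) - \<mu> * (\<Sum>j<Nf. ?H i j * y j k) = z * y i k"
      if i: "i < Nf" and k: "k < q" for i k
    proof -
      have "z * y i k = (\<Sum>l<q. Q $$ (k, l) * (z * v $ (i * q + l)))"
        unfolding y_def by (simp add: sum_distrib_left algebra_simps)
      also have "\<dots> = (\<Sum>l<q. Q $$ (k, l) * ((\<Sum>s<q. ?S $$ (l, s) * v $ (i * q + s))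
        - \<mu> * (\<Sum>j<Nf. ?H i j * v $ (j * q + l))))"
        using v_eq[OF i] by (intro sum.cong) auto
      also have "\<dots> = (\<Sum>l<q. Q $$ (k, l) * (\<Sum>s<q. ?S $$ (l, s) * v $ (i * q + s)))
        - (\<Sum>l<q. Q $$ (k, l) * (\<mu> * (\<Sum>j<Nf. ?H i j * v $ (j * q + l))))"
        by (simp add: right_diff_distrib sum_subtractf)
      also have "(\<Sum>l<q. Q $$ (k, l) * (\<mu> * (\<Sum>j<Nf. ?H i j * v $ (j * q + l))))
        = \<mu> * (\<Sum>j<Nf. ?H i j * y j k)"
        unfolding y_def by (simp add: sum_distrib_left algebra_simps) (rule sum.swap)
      also have "(\<Sum>l<q. Q $$ (k, l) * (\<Sum>s<q. ?S $$ (l, s) * v $ (i * q + s)))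
        = (\<Sum>s<q. (\<Sum>l<q. Q $$ (k, l) * ?S $$ (l, s)) * v $ (i * q + s))"
        by (simp only: sum_distrib_left sum_distrib_right mult.assoc) (rule sum.swap)
      also have "\<dots> = (\<Sum>s<q. (Q * ?S) $$ (k, s) * v $ (i * q + s))"
        using index_mult_mat_sum[OF wit(7) Sc k] by simp
      also have "\<dots> = (\<Sum>s<q. (\<Sum>l<q. B $$ (k, l) * Q $$ (l, s)) * v $ (i * q + s))"
        unfolding QS using index_mult_mat_sum[OF wit(5) wit(7) k] by simp
      also have "\<dots> = (\<Sum>l<q. B $$ (k, l) * y i l)"
        unfolding y_def by (simp only: sum_distrib_left sum_distrib_right mult.assoc) (rule sum.swap)
      finally show ?thesis by simp
    qed
    \<comment> \<open>\<open>P\<close> inverts the blockwise change of coordinates, so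
      \<open>y = 0\<close> would force \<open>v = 0\<close>.\<close>
    have "\<exists>i<Nf. \<exists>k<q. y i k \<noteq> 0"
    proof (rule ccontr)
      assume neg: "\<not> ?thesis"
      have "v $ (i * q + k) = 0" if i: "i < Nf" and k: "k < q" for i k
      proof -
        have "(\<Sum>l<q. P $$ (k, l) * y i l) = (\<Sum>s<q. (\<Sum>l<q. P $$ (k, l) * Q $$ (l, s)) * v $ (i * q + s))"
          unfolding y_def by (simp only: sum_distrib_left sum_distrib_right mult.assoc) (rule sum.swap)
        also have "\<dots> = (\<Sum>s<q. (P * Q) $$ (k, s) * v $ (i * q + s))"
          using index_mult_mat_sum[OF wit(6) wit(7) k] by simp
        also have "\<dots> = (\<Sum>s<q. if s = k then v $ (i * q + s) else 0)"
          unfolding wit(1) using k by (intro sum.cong) auto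
        finally show ?thesis using neg i k by simp
      qed
      then have "v $ s = 0" if "s < Nf * q" for s
      proof -
        have "0 < q" using that by (cases q) auto
        then have "s div q < Nf" "s mod q < q" using that by (auto simp: less_mult_imp_div_less)
        then have "v $ (s div q * q + s mod q) = 0" by fact
        then show ?thesis by simp
      qed
      then have "v = 0\<^sub>v (Nf * q)" using v(1) by (intro eq_vecI) auto
      with v(2) show False by simp
    qed
    then have ne: "{k. k < q \<and> (\<exists>i<Nf. y i k \<noteq> 0)} \<noteq> {}" (is "?K \<noteq> {}") by auto
    \<comment> \<open>Row \<open>k\<close> of \<open>B\<close> involves only slices from
      \<open>k\<close> on, and by maximality all slices after \<open>k\<close> vanish for every
      follower; only the diagonal term remains.\<close>
    define k where "k = Max ?K"
    have "k \<in> ?K" unfolding k_def using ne by (intro Max_in) auto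
    then obtain r where k: "k < q" and r: "r < Nf" "y r k \<noteq> 0" by auto
    have later: "y i l = 0" if "i < Nf" "k < l" "l < q" for i l
    proof (rule ccontr)
      assume "y i l \<noteq> 0"
      then have "l \<le> k" unfolding k_def using that by (intro Max_ge) auto
      with that show False by simp
    qed
    have diag: "(\<Sum>l<q. B $$ (k, l) * y i l) = B $$ (k, k) * y i k" if "i < Nf" for i
    proof -
      have "(\<Sum>l<q. B $$ (k, l) * y i l) = (\<Sum>l<q. if l = k then B $$ (k, k) * y i k else 0)"
      proof (intro sum.cong refl)
        fix l assume "l \<in> {..<q}"
        then show "B $$ (k, l) * y i l = (if l = k then B $$ (k, k) * y i k else 0)"
          using later[OF that, of l] upper_triangularD[OF ut, of l k] wit(5) k
          by (cases l k rule: linorder_cases) auto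
      qed
      then show ?thesis using k by simp
    qed
    have "?c \<le> Re ((B $$ (k, k) - z) / \<mu>)"
    proof (rule lapH_eigenvalue_Re_ge[OF adm eps, where y = "\<lambda>i. y i k"])
      show "(\<Sum>j<Nf. complex_of_real (?H i j) * y j k) = (B $$ (k, k) - z) / \<mu> * y i k" if "i < Nf" for i
        using y_eq[OF that k] diag[OF that] mu_pos by (simp add: field_simps)
    qed (use r in auto)
    then have "?c * \<mu> \<le> Re (B $$ (k, k)) - Re z"
      using mu_pos by (simp add: field_simps)
    then show ?thesis using m[OF k] mu_c by (simp add: mult.commute)
  qed
  then have "hurwitz (obs_mat Nf q S \<mu> (lapH Nf a a0))"
    if "m / ?c + 1 \<le> \<mu>" "admissible_graph Nf a a0 eps1 eps2" for \<mu> a a0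
    using that by (auto simp: hurwitz_def obs_mat_def)
  then show ?thesis by (rule that)
qed

section \<open>Regulator equations from data\<close>

text \<open>A maximal independent set of columns has \<open>n\<close> elements and so is a basis;
  hence every \<open>b\<close> is a combination of columns.\<close>

lemma (in vec_space) full_rank_surj:
  assumes A: "A \<in> carrier_mat n nc" and rank: "rank A = n" and b: "b \<in> carrier_vec n"
  obtains y where "y \<in> carrier_vec nc" "A *\<^sub>v y = b"
proof -
  have cols: "set (cols A) \<subseteq> carrier_vec n" using A cols_dim by blast
  obtain B where max: "maximal B (\<lambda>T. T \<subseteq> set (cols A) \<and> lin_indpt T)"
    using maximal_exists_superset[of "set (cols A)" "\<lambda>T. T \<subseteq> set (cols A) \<and> lin_indpt T" "{}"]
      finite_lin_indpt2[of "{}"] by auto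
  then have B: "B \<subseteq> set (cols A)" "lin_indpt B" by (auto simp: maximal_def)
  have card: "card B = n" using rank_card_indpt[OF A max] rank by simp
  have fin: "finite B" using B finite_subset by auto
  have "basis B"
    using B cols fin card by (intro dim_li_is_basis) (auto simp: dim_is_n)
  then have "span B = carrier_vec n" by (simp add: basis_def)
  then have "b \<in> span (set (cols A))" using b span_is_monotone[OF B(1)] by auto
  then have "b \<in> span_list (cols A)" using span_list_as_span[OF cols] by simp
  then obtain c where "b = lincomb_list c (cols A)" by (auto elim: in_span_listE)
  then have "b = mat_of_cols n (cols A) *\<^sub>v vec (length (cols A)) c"
    using lincomb_list_as_mat_mult[of "cols A" c] cols by (metis carrier_vecD subsetD)
  moreover have "mat_of_cols n (cols A) = A" using A by auto
  ultimately show ?thesis using A by (intro that[of "vec nc c"]) auto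
qed

section \<open>Stability of block triangular matrices\<close>

text \<open>The characteristic polynomial of a block triangular matrix is the product of those of
  its diagonal blocks.\<close>

lemma eigenvalue_four_block_lower_left_zero:
  fixes A D :: "complex mat"
  assumes A: "A \<in> carrier_mat n n" and C: "C \<in> carrier_mat n m" and D: "D \<in> carrier_mat m m"
    and ev: "eigenvalue (four_block_mat A C (0\<^sub>m m n) D) z"
  shows "eigenvalue A z \<or> eigenvalue D z"
proof -
  let ?M = "four_block_mat A C (0\<^sub>m m n) D"
  have M: "?M \<in> carrier_mat (n + m) (n + m)" using A D by simp
  have "char_poly ?M = char_poly A * char_poly D"
    using char_poly_factorized[OF A] char_poly_factorized[OF D]
    by (intro char_poly_0_block[OF refl _ _ A C D]) auto
  then show ?thesis
    using ev unfolding eigenvalue_root_char_poly[OF M] eigenvalue_root_char_poly[OF A]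
      eigenvalue_root_char_poly[OF D] by simp
qed

lemma map_mat_zero_of_real: "map_mat complex_of_real (0\<^sub>m n m) = 0\<^sub>m n m"
  by (intro eq_matI) auto

lemma hurwitz_four_block:
  assumes A: "A \<in> carrier_mat n n" and C: "C \<in> carrier_mat n m" and D: "D \<in> carrier_mat m m"
    and hurwitz: "hurwitz A" "hurwitz D"
  shows "hurwitz (four_block_mat A C (0\<^sub>m m n) D)"
proof -
  let ?c = "map_mat complex_of_real"
  have eq: "?c (four_block_mat A C (0\<^sub>m m n) D) = four_block_mat (?c A) (?c C) (0\<^sub>m m n) (?c D)"
    using map_four_block_mat[OF A C _ D, of "0\<^sub>m m n" complex_of_real]
      map_mat_zero_of_real by simp
  have c: "?c A \<in> carrier_mat n n" "?c C \<in> carrier_mat n m" "?c D \<in> carrier_mat m m"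
    using A C D by auto
  have "Re z < 0" if "eigenvalue (?c (four_block_mat A C (0\<^sub>m m n) D)) z" for z
    using eigenvalue_four_block_lower_left_zero[OF c that[unfolded eq]] hurwitz
    unfolding hurwitz_def by blast
  moreover have "dim_row (four_block_mat A C (0\<^sub>m m n) D) = dim_col (four_block_mat A C (0\<^sub>m m n) D)"
    using A D by simp
  ultimately show ?thesis unfolding hurwitz_def by blast
qed

lemma dim_bdiag [simp]:
  "dim_row (bdiag Ms) = sum_list (map dim_row Ms)"
  "dim_col (bdiag Ms) = sum_list (map dim_col Ms)"
  by (induction Ms) auto

lemma hurwitz_bdiag:
  assumes "\<forall>M\<in>set Ms. hurwitz M"
  shows "hurwitz (bdiag Ms)"
  using assms
proof (induction Ms)
  \<comment> \<open>The 0 by 0 matrix has no eigenvalue, because its only vector is zero.\<close>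
  case Nil
  then show ?case by (auto simp: hurwitz_def eigenvalue_def eigenvector_def)
next
  case (Cons M Ms)
  then have h: "hurwitz M" "hurwitz (bdiag Ms)" by auto
  then have sq: "dim_row M = dim_col M" "dim_row (bdiag Ms) = dim_col (bdiag Ms)"
    unfolding hurwitz_def by blast+
  have M: "M \<in> carrier_mat (dim_row M) (dim_row M)"
    by (rule carrier_matI[OF refl sq(1)[symmetric]])
  have Ms: "bdiag Ms \<in> carrier_mat (dim_row (bdiag Ms)) (dim_row (bdiag Ms))"
    by (rule carrier_matI[OF refl sq(2)[symmetric]])
  have Z: "0\<^sub>m (dim_row M) (dim_col (bdiag Ms)) \<in> carrier_mat (dim_row M) (dim_row (bdiag Ms))"
    unfolding sq(2) by (rule zero_carrier_mat)
  show ?case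
    unfolding bdiag.simps sq(1)[symmetric] by (rule hurwitz_four_block[OF M Z Ms h])
qed

section \<open>Generalized Sylvester equations\<close>

text \<open>Column \<open>k\<close> of the equation is a linear system for column \<open>k\<close>
  of \<open>Y\<close> with matrix \<open>M1 - B $$ (k, k) \<cdot>\<^sub>m M2\<close>, whose right
  side involves only earlier columns. The columns are therefore found from left to right.\<close>

lemma upper_triangular_sylvester:
  fixes M1 M2 B R :: "complex mat"
  assumes M1: "M1 \<in> carrier_mat r T" and M2: "M2 \<in> carrier_mat r T"
    and B: "B \<in> carrier_mat q q" and R: "R \<in> carrier_mat r q"
    and ut: "upper_triangular B"
    and surj: "\<And>k b. k < q \<Longrightarrow> b \<in> carrier_vec r \<Longrightarrow>
      \<exists>y\<in>carrier_vec T. (M1 - B $$ (k, k) \<cdot>\<^sub>m M2) *\<^sub>v y = b"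
  obtains Y where "Y \<in> carrier_mat T q" "M1 * Y - M2 * Y * B = R"
proof -
  have "\<exists>f. \<forall>j<k. \<forall>i<r. (\<Sum>l<T. M1 $$ (i, l) * f l j)
      - (\<Sum>s\<le>j. (\<Sum>l<T. M2 $$ (i, l) * f l s) * B $$ (s, j)) = R $$ (i, j)"
    if "k \<le> q" for k
    using that
  proof (induction k)
    case (Suc k)
    then obtain f where f: "\<And>j i. j < k \<Longrightarrow> i < r \<Longrightarrow> (\<Sum>l<T. M1 $$ (i, l) * f l j)
      - (\<Sum>s\<le>j. (\<Sum>l<T. M2 $$ (i, l) * f l s) * B $$ (s, j)) = R $$ (i, j)"
      by auto
    \<comment> \<open>The terms with \<open>s < k\<close> are already known and move to the right;
      the term \<open>s = k\<close> stays in the pencil.\<close>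
    define b where "b = vec r (\<lambda>i. R $$ (i, k)
        + (\<Sum>s<k. (\<Sum>l<T. M2 $$ (i, l) * f l s) * B $$ (s, k)))"
    obtain y where y: "y \<in> carrier_vec T" "(M1 - B $$ (k, k) \<cdot>\<^sub>m M2) *\<^sub>v y = b"
      using surj[of k b] Suc.prems by (auto simp: b_def)
    have y_eq: "(\<Sum>l<T. M1 $$ (i, l) * y $ l) - (\<Sum>l<T. M2 $$ (i, l) * y $ l) * B $$ (k, k)
        = b $ i" if i: "i < r" for i
    proof -
      have "b $ i = (\<Sum>l<T. (M1 - B $$ (k, k) \<cdot>\<^sub>m M2) $$ (i, l) * y $ l)"
        unfolding y(2)[symmetric] using M1 M2 y(1) i by (intro index_mult_mat_vec_sum) auto
      also have "\<dots> = (\<Sum>l<T. M1 $$ (i, l) * y $ l - M2 $$ (i, l) * y $ l * B $$ (k, k))"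
        using M1 M2 i by (intro sum.cong) (auto simp: algebra_simps)
      finally show ?thesis by (simp add: sum_subtractf sum_distrib_right)
    qed
    define g where "g l j = (if j = k then y $ l else f l j)" for l j
    have "(\<Sum>l<T. M1 $$ (i, l) * g l j)
      - (\<Sum>s\<le>j. (\<Sum>l<T. M2 $$ (i, l) * g l s) * B $$ (s, j)) = R $$ (i, j)"
      if "j < Suc k" "i < r" for i j
    proof (cases "j = k")
      case True
      have "(\<Sum>s\<le>k. (\<Sum>l<T. M2 $$ (i, l) * g l s) * B $$ (s, k))
        = (\<Sum>l<T. M2 $$ (i, l) * y $ l) * B $$ (k, k)
          + (\<Sum>s<k. (\<Sum>l<T. M2 $$ (i, l) * f l s) * B $$ (s, k))"
        by (simp add: g_def flip: lessThan_Suc_atMost)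
      then show ?thesis using y_eq[OF that(2)] True that(2)
        by (simp add: g_def b_def algebra_simps)
    next
      case False
      then have "j < k" using that by simp
      then show ?thesis using f[OF \<open>j < k\<close> that(2)] by (simp add: g_def)
    qed
    then show ?case by blast
  qed simp
  from this[OF order_refl] obtain f where f: "\<And>j i. j < q \<Longrightarrow> i < r \<Longrightarrow>
      (\<Sum>l<T. M1 $$ (i, l) * f l j)
      - (\<Sum>s\<le>j. (\<Sum>l<T. M2 $$ (i, l) * f l s) * B $$ (s, j)) = R $$ (i, j)"
    by blast
  define Y where "Y = mat T q (\<lambda>(l, j). f l j)"
  have Y: "Y \<in> carrier_mat T q" by (simp add: Y_def)
  have M2Y: "M2 * Y \<in> carrier_mat r q" using M2 Y by simp
  have mult_Y: "(M * Y) $$ (i, s) = (\<Sum>l<T. M $$ (i, l) * f l s)"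
    if "M \<in> carrier_mat r T" "i < r" "s < q" for M i s
    using index_mult_mat_sum[OF that(1) Y that(2,3)] that(3)
    by (simp add: Y_def del: index_mult_mat(1))
  have "M1 * Y - M2 * Y * B = R"
  proof (rule eq_matI)
    fix i j assume "i < dim_row R" "j < dim_col R"
    then have ij: "i < r" "j < q" using R by auto
    have "(M2 * Y * B) $$ (i, j) = (\<Sum>s<q. (M2 * Y) $$ (i, s) * B $$ (s, j))"
      by (rule index_mult_mat_sum[OF M2Y B ij])
    also have "\<dots> = (\<Sum>s\<le>j. (M2 * Y) $$ (i, s) * B $$ (s, j))"
      using ij ut B by (intro sum.mono_neutral_right) (auto simp: upper_triangularD)
    also have "\<dots> = (\<Sum>s\<le>j. (\<Sum>l<T. M2 $$ (i, l) * f l s) * B $$ (s, j))"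
      using ij by (intro sum.cong refl) (simp add: mult_Y[OF M2] del: index_mult_mat(1))
    finally have "(M1 * Y - M2 * Y * B) $$ (i, j) = (\<Sum>l<T. M1 $$ (i, l) * f l j)
      - (\<Sum>s\<le>j. (\<Sum>l<T. M2 $$ (i, l) * f l s) * B $$ (s, j))"
      using ij M2 B mult_Y[OF M1 ij] by (simp del: index_mult_mat(1))
    then show "(M1 * Y - M2 * Y * B) $$ (i, j) = R $$ (i, j)" using f ij by simp
  qed (use M2Y B R in auto)
  then show ?thesis using Y that by blast
qed

text \<open>The triangular equation is solved with right side \<open>R * P\<close> and multiplied by
  \<open>Q\<close> from the right. As \<open>B * Q = Q * S\<close> and \<open>P * Q\<close> is the
  identity, \<open>Y * Q\<close> solves the original one.\<close>

lemma complex_sylvester: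
  fixes M1 M2 S R :: "complex mat"
  assumes M1: "M1 \<in> carrier_mat r T" and M2: "M2 \<in> carrier_mat r T"
    and S: "S \<in> carrier_mat q q" and R: "R \<in> carrier_mat r q"
    and surj: "\<And>z b. eigenvalue S z \<Longrightarrow> b \<in> carrier_vec r \<Longrightarrow>
      \<exists>y\<in>carrier_vec T. (M1 - z \<cdot>\<^sub>m M2) *\<^sub>v y = b"
  obtains Y where "Y \<in> carrier_mat T q" "M1 * Y - M2 * (Y * S) = R"
proof -
  obtain B P Q where sim: "similar_mat_wit S B P Q" and ut: "upper_triangular B"
    and QS: "Q * S = B * Q" and ev: "\<And>k. k < q \<Longrightarrow> eigenvalue S (B $$ (k, k))"
    using complex_schur[OF S] by metis
  note wit = similar_mat_witD2[OF S sim]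
  have RP: "R * P \<in> carrier_mat r q" using R wit(6) by simp
  obtain Y where Y: "Y \<in> carrier_mat T q" "M1 * Y - M2 * Y * B = R * P"
    using upper_triangular_sylvester[OF M1 M2 wit(5) RP ut] surj ev by metis
  have M1Y: "M1 * Y \<in> carrier_mat r q" and M2Y: "M2 * Y \<in> carrier_mat r q"
    and YQ: "Y * Q \<in> carrier_mat T q" using M1 M2 Y wit(7) by auto
  have "M2 * (Y * Q * S) = M2 * (Y * (B * Q))"
    using Y(1) wit(7) S by (simp add: assoc_mult_mat[of _ T q _ q _ q] QS)
  also have "Y * (B * Q) = Y * B * Q"
    by (rule assoc_mult_mat[symmetric, OF Y(1) wit(5,7)])
  also have "M2 * (Y * B * Q) = M2 * (Y * B) * Q"
    using Y(1) wit(5) by (intro assoc_mult_mat[symmetric, OF M2 _ wit(7)]) simp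
  also have "M2 * (Y * B) = M2 * Y * B"
    by (rule assoc_mult_mat[symmetric, OF M2 Y(1) wit(5)])
  finally have "M1 * (Y * Q) - M2 * (Y * Q * S) = M1 * Y * Q - M2 * Y * B * Q"
    using M1 Y(1) wit(7) by simp
  also have "\<dots> = (M1 * Y - M2 * Y * B) * Q"
    using M1Y M2Y wit(5,7) by (intro minus_mult_distrib_mat[symmetric]) auto
  also have "\<dots> = R * (P * Q)"
    unfolding Y(2) using R wit(6,7) by simp
  also have "\<dots> = R" using R wit(1) by simp
  finally show ?thesis using YQ that by blast
qed

lemma map_mat_Re_of_real_mult:
  assumes A: "A \<in> carrier_mat nr n" and B: "B \<in> carrier_mat n nc"
  shows "map_mat Re (map_mat complex_of_real A * B) = A * map_mat Re B"
proof (rule eq_matI)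
  fix i j assume "i < dim_row (A * map_mat Re B)" "j < dim_col (A * map_mat Re B)"
  then have ij: "i < nr" "j < nc" using A B by auto
  have Ac: "map_mat complex_of_real A \<in> carrier_mat nr n" and Br: "map_mat Re B \<in> carrier_mat n nc"
    using A B by auto
  show "map_mat Re (map_mat complex_of_real A * B) $$ (i, j) = (A * map_mat Re B) $$ (i, j)"
    using ij A B index_mult_mat_sum[OF Ac B ij] index_mult_mat_sum[OF A Br ij]
    by (simp del: index_mult_mat(1) add: index_mult_mat(2,3))
qed (use A B in auto)

lemma map_mat_Re_mult_of_real:
  assumes A: "A \<in> carrier_mat nr n" and B: "B \<in> carrier_mat n nc"
  shows "map_mat Re (A * map_mat complex_of_real B) = map_mat Re A * B"
proof (rule eq_matI)
  fix i j assume "i < dim_row (map_mat Re A * B)" "j < dim_col (map_mat Re A * B)"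
  then have ij: "i < nr" "j < nc" using A B by auto
  have Bc: "map_mat complex_of_real B \<in> carrier_mat n nc" and Ar: "map_mat Re A \<in> carrier_mat nr n"
    using A B by auto
  show "map_mat Re (A * map_mat complex_of_real B) $$ (i, j) = (map_mat Re A * B) $$ (i, j)"
    using ij A B index_mult_mat_sum[OF A Bc ij] index_mult_mat_sum[OF Ar B ij]
    by (simp del: index_mult_mat(1) add: index_mult_mat(2,3))
qed (use A B in auto)

text \<open>Eigenvalues of \<open>S\<close> may be complex, so the equation is solved over the
  complex numbers first. Its coefficients are real, hence the real part of a solution is again a
  solution.\<close>

lemma real_sylvester:
  fixes M1 M2 S R :: "real mat"
  assumes M1: "M1 \<in> carrier_mat r T" and M2: "M2 \<in> carrier_mat r T"
    and S: "S \<in> carrier_mat q q" and R: "R \<in> carrier_mat r q"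
    and surj: "\<And>z b. z \<in> spec S \<Longrightarrow> b \<in> carrier_vec r \<Longrightarrow>
      \<exists>y\<in>carrier_vec T. (map_mat complex_of_real M1 - z \<cdot>\<^sub>m map_mat complex_of_real M2) *\<^sub>v y = b"
  obtains Y where "Y \<in> carrier_mat T q" "M1 * Y - M2 * (Y * S) = R"
proof -
  let ?c = "map_mat complex_of_real"
  have c: "?c M1 \<in> carrier_mat r T" "?c M2 \<in> carrier_mat r T" "?c S \<in> carrier_mat q q"
    "?c R \<in> carrier_mat r q" using M1 M2 S R by auto
  obtain Y where Y: "Y \<in> carrier_mat T q" "?c M1 * Y - ?c M2 * (Y * ?c S) = ?c R"
    using complex_sylvester[OF c] surj unfolding spec_def by blast
  have YS: "Y * ?c S \<in> carrier_mat T q" using Y(1) c(3) by simp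
  have "R = map_mat Re (?c R)" by (intro eq_matI) auto
  also have "\<dots> = map_mat Re (?c M1 * Y) - map_mat Re (?c M2 * (Y * ?c S))"
    unfolding Y(2)[symmetric] using M1 M2 Y(1) S by (intro eq_matI) auto
  also have "\<dots> = M1 * map_mat Re Y - M2 * (map_mat Re Y * S)"
    by (simp add: map_mat_Re_of_real_mult[OF M1 Y(1)] map_mat_Re_of_real_mult[OF M2 YS]
        map_mat_Re_mult_of_real[OF Y(1) S])
  finally show ?thesis using Y(1) by (intro that[of "map_mat Re Y"]) auto
qed

section \<open>The two regulator equations as one stacked equation\<close>

lemma vstack_carrier [simp]:
  "A \<in> carrier_mat n c \<Longrightarrow> B \<in> carrier_mat m c \<Longrightarrow> vstack A B \<in> carrier_mat (n + m) c"
  by (auto simp: vstack_def)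

lemma map_vstack_pencil:
  assumes P: "P \<in> carrier_mat n c" and Q: "Q \<in> carrier_mat m c" and X: "X \<in> carrier_mat n c"
  shows "map_mat complex_of_real (vstack P Q) - z \<cdot>\<^sub>m map_mat complex_of_real (vstack X (0\<^sub>m m c))
    = vstack (map_mat complex_of_real P - z \<cdot>\<^sub>m map_mat complex_of_real X) (map_mat complex_of_real Q)"
  using assms by (intro eq_matI) (auto simp: vstack_def)

lemma vstack_mult:
  assumes "A \<in> carrier_mat n c" "B \<in> carrier_mat m c" "Y \<in> carrier_mat c d"
  shows "vstack A B * Y = vstack (A * Y) (B * Y)"
  using assms by (intro eq_matI) (auto simp: vstack_def scalar_prod_def)

lemma vstack_minus:
  fixes A B :: "'a::group_add mat"
  assumes "A \<in> carrier_mat n c" "B \<in> carrier_mat m c" "C \<in> carrier_mat n c" "D \<in> carrier_mat m c"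
  shows "vstack A B - vstack C D = vstack (A - C) (B - D)"
  using assms by (intro eq_matI) (auto simp: vstack_def)

lemma vstack_eqD:
  assumes "vstack A B = vstack A' B'" "A \<in> carrier_mat n c" "B \<in> carrier_mat m c"
    "A' \<in> carrier_mat n c" "B' \<in> carrier_mat m c"
  shows "A = A'" "B = B'"
proof -
  have top: "vstack M N $$ (i, j) = M $$ (i, j)"
    if "M \<in> carrier_mat n c" "N \<in> carrier_mat m c" "i < n" "j < c" for M N :: "'a mat" and i j
    using that by (auto simp: vstack_def)
  have bottom: "vstack M N $$ (n + i, j) = N $$ (i, j)"
    if "M \<in> carrier_mat n c" "N \<in> carrier_mat m c" "i < m" "j < c" for M N :: "'a mat" and i j
    using that by (auto simp: vstack_def)
  have "A $$ (i, j) = A' $$ (i, j)" if "i < n" "j < c" for i j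
    using top[OF assms(2,3) that] top[OF assms(4,5) that] assms(1) by simp
  then show "A = A'" using assms(2,4) by (intro eq_matI) auto
  have "B $$ (i, j) = B' $$ (i, j)" if "i < m" "j < c" for i j
    using bottom[OF assms(2,3) that] bottom[OF assms(4,5) that] assms(1) by simp
  then show "B = B'" using assms(3,5) by (intro eq_matI) auto
qed

text \<open>Stacked, the two equations form one Sylvester equation with
  \<open>M2 = vstack X 0\<close> and right side \<open>vstack (- E) (- F)\<close>. Its pencil at
  \<open>z\<close> is \<open>dd_tz_mat\<close>, so the rank condition is precisely the surjectivity
  that solvability asks for.\<close>

lemma data_regulator_equations:
  assumes X: "X \<in> carrier_mat n T" and Ecal: "Ecal \<in> carrier_mat p T"
    and V: "V \<in> carrier_mat q T" and D11: "D11 \<in> carrier_mat T T"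
    and E: "E \<in> carrier_mat n q" and F: "F \<in> carrier_mat p q" and S: "S \<in> carrier_mat q q"
    and rank: "\<forall>z\<in>spec S. vec_space.rank (n + p) (dd_tz_mat X Ecal V D11 E F z) = n + p"
  obtains Y where "Y \<in> carrier_mat T q"
    "(X * D11 - E * V) * Y + E = X * Y * S" "(Ecal - F * V) * Y + F = 0\<^sub>m p q"
proof -
  let ?c = "map_mat complex_of_real"
  let ?P = "X * D11 - E * V" and ?Q = "Ecal - F * V"
  have P: "?P \<in> carrier_mat n T" and Q: "?Q \<in> carrier_mat p T"
    using X D11 E V Ecal F by auto
  have M1: "vstack ?P ?Q \<in> carrier_mat (n + p) T"
    and M2: "vstack X (0\<^sub>m p T) \<in> carrier_mat (n + p) T"
    and R: "vstack (- E) (- F) \<in> carrier_mat (n + p) q"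
    using P Q X E F by auto
  have pencil: "?c (vstack ?P ?Q) - z \<cdot>\<^sub>m ?c (vstack X (0\<^sub>m p T)) = dd_tz_mat X Ecal V D11 E F z" for z
    unfolding dd_tz_mat_def by (rule map_vstack_pencil[OF P Q X])
  have "\<exists>y\<in>carrier_vec T. (?c (vstack ?P ?Q) - z \<cdot>\<^sub>m ?c (vstack X (0\<^sub>m p T))) *\<^sub>v y = b"
    if z: "z \<in> spec S" and b: "b \<in> carrier_vec (n + p)" for z b
  proof -
    have "?c (vstack ?P ?Q) - z \<cdot>\<^sub>m ?c (vstack X (0\<^sub>m p T)) \<in> carrier_mat (n + p) T"
      using M1 M2 by auto
    moreover have "vec_space.rank (n + p) (?c (vstack ?P ?Q) - z \<cdot>\<^sub>m ?c (vstack X (0\<^sub>m p T))) = n + p"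
      unfolding pencil using rank z by blast
    ultimately obtain y where "y \<in> carrier_vec T"
        "(?c (vstack ?P ?Q) - z \<cdot>\<^sub>m ?c (vstack X (0\<^sub>m p T))) *\<^sub>v y = b"
      by (rule vec_space.full_rank_surj[OF _ _ b])
    then show ?thesis by blast
  qed
  then obtain Y where Y: "Y \<in> carrier_mat T q"
    and eq: "vstack ?P ?Q * Y - vstack X (0\<^sub>m p T) * (Y * S) = vstack (- E) (- F)"
    by (rule real_sylvester[OF M1 M2 S R])
  have YS: "Y * S \<in> carrier_mat T q" using Y S by simp
  have PY: "?P * Y \<in> carrier_mat n q" and XYS: "X * (Y * S) \<in> carrier_mat n q"
    and QY: "?Q * Y \<in> carrier_mat p q"
    using P Q X Y YS by auto
  have zeros: "0\<^sub>m p T * (Y * S) = 0\<^sub>m p q" by (rule left_mult_zero_mat[OF YS])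
  have minus_zero: "M - 0\<^sub>m p q = M" if "M \<in> carrier_mat p q" for M :: "real mat"
    using that by (intro eq_matI) auto
  have "vstack ?P ?Q * Y - vstack X (0\<^sub>m p T) * (Y * S)
      = vstack (?P * Y - X * (Y * S)) (?Q * Y)"
    unfolding vstack_mult[OF P Q Y] vstack_mult[OF X zero_carrier_mat YS] zeros
      vstack_minus[OF PY QY XYS zero_carrier_mat] minus_zero[OF QY] ..
  with eq have eq': "vstack (?P * Y - X * (Y * S)) (?Q * Y) = vstack (- E) (- F)" by simp
  have uminus: "- E \<in> carrier_mat n q" "- F \<in> carrier_mat p q" using E F by auto
  note eqs = vstack_eqD[OF eq' minus_carrier_mat[OF XYS] QY uminus]
  have minus_eqD: "M + K = L" if "M - L = - K" "M \<in> carrier_mat n q" "L \<in> carrier_mat n q" "K \<in> carrier_mat n q"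
    for M L K :: "real mat"
  proof (rule eq_matI)
    fix i j assume "i < dim_row L" "j < dim_col L"
    then show "(M + K) $$ (i, j) = L $$ (i, j)"
      using arg_cong[OF that(1), of "\<lambda>A. A $$ (i, j)"] that(2-4) by auto
  qed (use that in auto)
  have "?P * Y + E = X * (Y * S)" by (rule minus_eqD[OF eqs(1) PY XYS E])
  also have "\<dots> = X * Y * S" by (rule assoc_mult_mat[symmetric, OF X Y S])
  finally have "?P * Y + E = X * Y * S" .
  moreover have "?Q * Y + F = 0\<^sub>m p q" unfolding eqs(2) using F by simp
  ultimately show ?thesis by (rule that[OF Y])
qed

section \<open>The closed loop\<close>

lemma follower_output_split:
  fixes M N :: "real mat"
  assumes M: "M \<in> carrier_mat r n" and N: "N \<in> carrier_mat r m" and L: "L \<in> carrier_mat r q"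
    and K1: "K1 \<in> carrier_mat m n" and K2: "K2 \<in> carrier_mat m q"
    and x: "x \<in> carrier_vec n" and \<eta>: "\<eta> \<in> carrier_vec q" and v: "v \<in> carrier_vec q" and k: "k < r"
  shows "(M *\<^sub>v x + N *\<^sub>v ctrl K1 K2 x \<eta> + L *\<^sub>v v) $ k
    = (\<Sum>j<n. (M + N * K1) $$ (k, j) * x $ j) + (\<Sum>l<q. (N * K2) $$ (k, l) * \<eta> $ l)
      + (\<Sum>l<q. L $$ (k, l) * v $ l)"
proof -
  have NK1: "N * K1 \<in> carrier_mat r n" and NK2: "N * K2 \<in> carrier_mat r q"
    and MNK: "M + N * K1 \<in> carrier_mat r n"
    using M N K1 K2 by auto
  have K1x: "K1 *\<^sub>v x \<in> carrier_vec m" and K2\<eta>: "K2 *\<^sub>v \<eta> \<in> carrier_vec m"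
    by (rule mult_mat_vec_carrier[OF K1 x], rule mult_mat_vec_carrier[OF K2 \<eta>])
  have "N *\<^sub>v ctrl K1 K2 x \<eta> = (N * K1) *\<^sub>v x + (N * K2) *\<^sub>v \<eta>"
    unfolding ctrl_def mult_add_distrib_mat_vec[OF N K1x K2\<eta>]
      assoc_mult_mat_vec[OF N K1 x] assoc_mult_mat_vec[OF N K2 \<eta>] ..
  then have "(M *\<^sub>v x + N *\<^sub>v ctrl K1 K2 x \<eta> + L *\<^sub>v v) $ k
      = (M *\<^sub>v x) $ k + ((N * K1) *\<^sub>v x) $ k + ((N * K2) *\<^sub>v \<eta>) $ k + (L *\<^sub>v v) $ k"
    using M N L k by simp
  also have "(M *\<^sub>v x) $ k + ((N * K1) *\<^sub>v x) $ k = ((M + N * K1) *\<^sub>v x) $ k"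
    unfolding add_mult_distrib_mat_vec[OF M NK1 x] using M N k by simp
  also have "\<dots> = (\<Sum>j<n. (M + N * K1) $$ (k, j) * x $ j)"
    by (rule index_mult_mat_vec_sum[OF MNK x k])
  finally show ?thesis
    by (simp only: index_mult_mat_vec_sum[OF NK2 \<eta> k] index_mult_mat_vec_sum[OF L v k])
qed

text \<open>The subtracted matrix is the left side of a regulator equation, equal to
  \<open>P * S\<close> for the state and to 0 for the output. The generic \<open>M\<close>,
  \<open>N\<close>, \<open>L\<close> and row count \<open>r\<close> let one identity serve
  both.\<close>

lemma follower_error_split:
  fixes M N :: "real mat"
  assumes M: "M \<in> carrier_mat r n" and N: "N \<in> carrier_mat r m" and L: "L \<in> carrier_mat r q"
    and K1: "K1 \<in> carrier_mat m n" and K2: "K2 \<in> carrier_mat m q" and P: "P \<in> carrier_mat n q"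
    and x: "x \<in> carrier_vec n" and \<eta>: "\<eta> \<in> carrier_vec q" and v: "v \<in> carrier_vec q" and k: "k < r"
  shows "(M *\<^sub>v x + N *\<^sub>v ctrl K1 K2 x \<eta> + L *\<^sub>v v) $ k
      - (((M + N * K1) * P + N * K2 + L) *\<^sub>v v) $ k
    = (\<Sum>j<n. (M + N * K1) $$ (k, j) * (x $ j - (P *\<^sub>v v) $ j))
      + (\<Sum>l<q. (N * K2) $$ (k, l) * (\<eta> $ l - v $ l))"
proof -
  have NK2: "N * K2 \<in> carrier_mat r q" and MNK: "M + N * K1 \<in> carrier_mat r n"
    using M N K1 K2 by auto
  then have MP: "(M + N * K1) * P \<in> carrier_mat r q" using P by simp
  have Pv: "P *\<^sub>v v \<in> carrier_vec n" by (rule mult_mat_vec_carrier[OF P v])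
  have "(((M + N * K1) * P + N * K2 + L) *\<^sub>v v)
      = (M + N * K1) *\<^sub>v (P *\<^sub>v v) + (N * K2) *\<^sub>v v + L *\<^sub>v v"
    unfolding add_mult_distrib_mat_vec[OF add_carrier_mat[OF NK2] L v]
      add_mult_distrib_mat_vec[OF MP NK2 v] assoc_mult_mat_vec[OF MNK P v] ..
  then have "(((M + N * K1) * P + N * K2 + L) *\<^sub>v v) $ k
      = ((M + N * K1) *\<^sub>v (P *\<^sub>v v)) $ k + ((N * K2) *\<^sub>v v) $ k + (L *\<^sub>v v) $ k"
    using MNK N L k by simp
  also have "\<dots> = (\<Sum>j<n. (M + N * K1) $$ (k, j) * (P *\<^sub>v v) $ j)
      + (\<Sum>l<q. (N * K2) $$ (k, l) * v $ l) + (\<Sum>l<q. L $$ (k, l) * v $ l)"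
    by (simp only: index_mult_mat_vec_sum[OF MNK Pv k] index_mult_mat_vec_sum[OF NK2 v k]
        index_mult_mat_vec_sum[OF L v k])
  finally show ?thesis
    unfolding follower_output_split[OF M N L K1 K2 x \<eta> v k]
    by (simp add: right_diff_distrib sum_subtractf)
qed

lemma cl_solution_carrier:
  assumes "cl_solution Nf n q S \<mu> a a0 A B E K1 K2 v x \<eta>"
  shows "v t \<in> carrier_vec q"
    and "i < Nf \<Longrightarrow> x i t \<in> carrier_vec (n i)"
    and "i < Nf \<Longrightarrow> \<eta> i t \<in> carrier_vec q"
  using assms unfolding cl_solution_def vderiv_def by (blast intro: carrier_vecI)+

lemma cl_solution_deriv:
  assumes sol: "cl_solution Nf n q S \<mu> a a0 A B E K1 K2 v x \<eta>"
  shows "k < q \<Longrightarrow> ((\<lambda>s. v s $ k) has_real_derivative (S *\<^sub>v v t) $ k) (at t)"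
    and "i < Nf \<Longrightarrow> k < n i \<Longrightarrow> ((\<lambda>s. x i s $ k) has_real_derivative
      (A i *\<^sub>v x i t + B i *\<^sub>v ctrl (K1 i) (K2 i) (x i t) (\<eta> i t) + E i *\<^sub>v v t) $ k) (at t)"
    and "i < Nf \<Longrightarrow> k < q \<Longrightarrow> ((\<lambda>s. \<eta> i s $ k) has_real_derivative ((S *\<^sub>v \<eta> i t) $ k +
      \<mu> * ((\<Sum>j<Nf. a i j * (\<eta> j t $ k - \<eta> i t $ k)) + a0 i * (v t $ k - \<eta> i t $ k)))) (at t)"
proof -
  have v: "vderiv v q (\<lambda>t. S *\<^sub>v v t)"
    and x: "\<forall>i<Nf. vderiv (x i) (n i)
      (\<lambda>t. A i *\<^sub>v x i t + B i *\<^sub>v ctrl (K1 i) (K2 i) (x i t) (\<eta> i t) + E i *\<^sub>v v t)"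
    and \<eta>: "\<forall>i<Nf. vderiv (\<eta> i) q (\<lambda>t. vec q (\<lambda>k. (S *\<^sub>v \<eta> i t) $ k +
      \<mu> * ((\<Sum>j<Nf. a i j * (\<eta> j t $ k - \<eta> i t $ k)) + a0 i * (v t $ k - \<eta> i t $ k))))"
    using sol unfolding cl_solution_def by blast+
  show "k < q \<Longrightarrow> ((\<lambda>s. v s $ k) has_real_derivative (S *\<^sub>v v t) $ k) (at t)"
    using v unfolding vderiv_def by blast
  show "i < Nf \<Longrightarrow> k < n i \<Longrightarrow> ((\<lambda>s. x i s $ k) has_real_derivative
      (A i *\<^sub>v x i t + B i *\<^sub>v ctrl (K1 i) (K2 i) (x i t) (\<eta> i t) + E i *\<^sub>v v t) $ k) (at t)"
    using x unfolding vderiv_def by blast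
  assume i: "i < Nf" and k: "k < q"
  have "((\<lambda>s. \<eta> i s $ k) has_real_derivative vec q (\<lambda>k. (S *\<^sub>v \<eta> i t) $ k +
      \<mu> * ((\<Sum>j<Nf. a i j * (\<eta> j t $ k - \<eta> i t $ k)) + a0 i * (v t $ k - \<eta> i t $ k))) $ k) (at t)"
    using \<eta> i k unfolding vderiv_def by blast
  then show "((\<lambda>s. \<eta> i s $ k) has_real_derivative ((S *\<^sub>v \<eta> i t) $ k +
      \<mu> * ((\<Sum>j<Nf. a i j * (\<eta> j t $ k - \<eta> i t $ k)) + a0 i * (v t $ k - \<eta> i t $ k)))) (at t)"
    unfolding index_vec[OF k] .
qed

text \<open>The leader moves by the same \<open>S\<close>, so the stacked error
  \<open>\<eta> - v\<close> obeys the homogeneous equation given by the observer matrix; the unknown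
  graph enters only through that matrix.\<close>

lemma observer_error_tendsto_zero:
  assumes sol: "cl_solution Nf n q S \<mu> a a0 A B E K1 K2 v x \<eta>"
    and S: "S \<in> carrier_mat q q"
    and hurwitz: "hurwitz (obs_mat Nf q S \<mu> (lapH Nf a a0))"
    and i: "i < Nf" and k: "k < q"
  shows "((\<lambda>t. \<eta> i t $ k - v t $ k) \<longlongrightarrow> 0) at_top"
proof -
  let ?H = "lapH Nf a a0"
  let ?O = "obs_mat Nf q S \<mu> ?H"
  note v_dim = cl_solution_carrier(1)[OF sol] and \<eta>_dim = cl_solution_carrier(3)[OF sol]
  note v_deriv = cl_solution_deriv(1)[OF sol] and \<eta>_deriv = cl_solution_deriv(3)[OF sol]
  define \<delta> where "\<delta> t s = \<eta> (s div q) t $ (s mod q) - v t $ (s mod q)" for t s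
  have \<delta>_block: "\<delta> t (i * q + k) = \<eta> i t $ k - v t $ k" if "k < q" for t i k
    using that by (simp add: \<delta>_def)
  have \<delta>_deriv: "((\<lambda>u. \<delta> u (i * q + k)) has_real_derivative
      (\<Sum>s<Nf * q. ?O $$ (i * q + k, s) * \<delta> t s)) (at t)"
    if i: "i < Nf" and k: "k < q" for i k t
  proof -
    have S_part: "(S *\<^sub>v \<eta> i t) $ k - (S *\<^sub>v v t) $ k = (\<Sum>l<q. S $$ (k, l) * \<delta> t (i * q + l))"
      using index_mult_mat_vec_sum[OF S \<eta>_dim[OF i] k] index_mult_mat_vec_sum[OF S v_dim k]
      by (simp add: \<delta>_block right_diff_distrib sum_subtractf del: index_mult_mat_vec)
    \<comment> \<open>A self-loop weight \<open>a i i\<close> multiplies a zero difference, in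
      agreement with \<open>lap_deg\<close>, which leaves it out.\<close>
    have "(\<Sum>j<Nf. a i j * (\<eta> j t $ k - \<eta> i t $ k))
        = (\<Sum>j\<in>{..<Nf} - {i}. a i j * (\<eta> j t $ k - \<eta> i t $ k))"
      using i by (subst sum.remove[of _ i]) auto
    also have "\<dots> = (\<Sum>j\<in>{..<Nf} - {i}. a i j * \<delta> t (j * q + k))
        - (\<Sum>j\<in>{..<Nf} - {i}. a i j) * \<delta> t (i * q + k)"
      using k by (simp add: \<delta>_block sum_distrib_right right_diff_distrib sum_subtractf)
    finally have "(\<Sum>j<Nf. a i j * (\<eta> j t $ k - \<eta> i t $ k)) + a0 i * (v t $ k - \<eta> i t $ k)
        = (\<Sum>j\<in>{..<Nf} - {i}. a i j * \<delta> t (j * q + k)) - lap_deg Nf a a0 i * \<delta> t (i * q + k)"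
      using k by (simp add: \<delta>_block lap_deg_def right_diff_distrib distrib_right)
    also have "\<dots> = - (\<Sum>j<Nf. ?H i j * \<delta> t (j * q + k))"
      using i by (subst sum.remove[of _ i]) (auto simp: lapH_def sum_negf[symmetric] intro!: sum.cong)
    finally have H_part: "(\<Sum>j<Nf. a i j * (\<eta> j t $ k - \<eta> i t $ k)) + a0 i * (v t $ k - \<eta> i t $ k)
        = - (\<Sum>j<Nf. ?H i j * \<delta> t (j * q + k))" .
    have row: "(\<Sum>s<Nf * q. ?O $$ (i * q + k, s) * \<delta> t s)
        = (\<Sum>l<q. S $$ (k, l) * \<delta> t (i * q + l)) - \<mu> * (\<Sum>j<Nf. ?H i j * \<delta> t (j * q + k))"
      using obs_mat_row_sum[OF i k, of S \<mu> ?H "\<delta> t"] by simp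
    have "((\<lambda>u. \<eta> i u $ k - v u $ k) has_real_derivative
        (S *\<^sub>v \<eta> i t) $ k + \<mu> * (- (\<Sum>j<Nf. ?H i j * \<delta> t (j * q + k))) - (S *\<^sub>v v t) $ k) (at t)"
      unfolding H_part[symmetric] by (rule DERIV_diff[OF \<eta>_deriv[OF i k] v_deriv[OF k]])
    also have "(S *\<^sub>v \<eta> i t) $ k + \<mu> * (- (\<Sum>j<Nf. ?H i j * \<delta> t (j * q + k))) - (S *\<^sub>v v t) $ k
        = (\<Sum>s<Nf * q. ?O $$ (i * q + k, s) * \<delta> t s)"
      unfolding row S_part[symmetric] by simp
    finally show ?thesis using k by (simp add: \<delta>_block)
  qed
  have "((\<lambda>t. \<delta> t (i * q + k)) \<longlongrightarrow> 0) at_top"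
  proof (rule hurwitz_forced_ode_tendsto_zero[OF _ hurwitz, where g = "\<lambda>t s. 0"])
    show "?O \<in> carrier_mat (Nf * q) (Nf * q)" by (simp add: obs_mat_def)
    show "i * q + k < Nf * q" by (rule block_index_less[OF i k])
    show "((\<lambda>u. \<delta> u s) has_real_derivative (\<Sum>j<Nf * q. ?O $$ (s, j) * \<delta> t j) + 0) (at t)"
      if "s < Nf * q" for t s
    proof -
      have "0 < q" using that by (cases q) auto
      then have "s div q < Nf" "s mod q < q" using that by (auto simp: less_mult_imp_div_less)
      from \<delta>_deriv[OF this, of t] show ?thesis by simp
    qed
  qed simp
  then show ?thesis using k by (simp add: \<delta>_block)
qed

text \<open>By the first regulator equation \<open>P v\<close> follows the state equation driven by
  the true \<open>v\<close>, so \<open>\<xi> = x - P v\<close> sees only the observer error as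
  forcing. By the second, the tracking error is a linear combination of \<open>\<xi>\<close> and the
  observer error.\<close>

lemma track_err_tendsto_zero:
  assumes sol: "cl_solution Nf n q S \<mu> a a0 A B E K1 K2 v x \<eta>"
    and S: "S \<in> carrier_mat q q"
    and hurwitz_obs: "hurwitz (obs_mat Nf q S \<mu> (lapH Nf a a0))"
    and i: "i < Nf"
    and A: "A i \<in> carrier_mat (n i) (n i)" and B: "B i \<in> carrier_mat (n i) m"
    and C: "C \<in> carrier_mat p (n i)" and D: "D \<in> carrier_mat p m"
    and E: "E i \<in> carrier_mat (n i) q" and F: "F \<in> carrier_mat p q"
    and K1: "K1 i \<in> carrier_mat m (n i)" and K2: "K2 i \<in> carrier_mat m q"
    and P: "P \<in> carrier_mat (n i) q"
    and hurwitz: "hurwitz (A i + B i * K1 i)"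
    and reg: "(A i + B i * K1 i) * P + B i * K2 i + E i = P * S"
      "(C + D * K1 i) * P + D * K2 i + F = 0\<^sub>m p q"
    and k: "k < p"
  shows "((\<lambda>t. track_err C D F (K1 i) (K2 i) (x i t) (\<eta> i t) (v t) $ k) \<longlongrightarrow> 0) at_top"
proof -
  let ?G = "A i + B i * K1 i" and ?W = "B i * K2 i"
  have G: "?G \<in> carrier_mat (n i) (n i)" using A B K1 by simp
  note v_dim = cl_solution_carrier(1)[OF sol] and x_dim = cl_solution_carrier(2)[OF sol i]
    and \<eta>_dim = cl_solution_carrier(3)[OF sol i]
  note v_deriv = cl_solution_deriv(1)[OF sol] and x_deriv = cl_solution_deriv(2)[OF sol i]
  have \<delta>_lim: "((\<lambda>t. \<eta> i t $ l - v t $ l) \<longlongrightarrow> 0) at_top" if "l < q" for l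
    by (rule observer_error_tendsto_zero[OF sol S hurwitz_obs i that])
  define \<xi> where "\<xi> t l = x i t $ l - (P *\<^sub>v v t) $ l" for t l
  define g where "g t l = (\<Sum>s<q. ?W $$ (l, s) * (\<eta> i t $ s - v t $ s))" for t l
  have \<xi>_deriv: "((\<lambda>s. \<xi> s l) has_real_derivative (\<Sum>j<n i. ?G $$ (l, j) * \<xi> t j) + g t l) (at t)"
    if l: "l < n i" for t l
  proof -
    have Sv: "S *\<^sub>v v t \<in> carrier_vec q" by (rule mult_mat_vec_carrier[OF S v_dim])
    have "((\<lambda>s. \<Sum>j<q. P $$ (l, j) * v s $ j) has_real_derivative
        (\<Sum>j<q. P $$ (l, j) * (S *\<^sub>v v t) $ j)) (at t)"
      by (intro DERIV_sum DERIV_cmult v_deriv) simp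
    then have "((\<lambda>s. (P *\<^sub>v v s) $ l) has_real_derivative (P *\<^sub>v (S *\<^sub>v v t)) $ l) (at t)"
      by (simp only: index_mult_mat_vec_sum[OF P v_dim l] index_mult_mat_vec_sum[OF P Sv l])
    also have "P *\<^sub>v (S *\<^sub>v v t) = (?G * P + ?W + E i) *\<^sub>v v t"
      unfolding reg(1) by (rule assoc_mult_mat_vec[OF P S v_dim, symmetric])
    finally have "((\<lambda>s. (P *\<^sub>v v s) $ l) has_real_derivative ((?G * P + ?W + E i) *\<^sub>v v t) $ l) (at t)" .
    from DERIV_diff[OF x_deriv[OF l] this] show ?thesis
      unfolding follower_error_split[OF A B E K1 K2 P x_dim \<eta>_dim v_dim l] \<xi>_def g_def .
  qed
  have g_lim: "((\<lambda>t. g t l) \<longlongrightarrow> 0) at_top" for l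
    unfolding g_def by (intro tendsto_null_sum tendsto_mult_right_zero) (auto intro: \<delta>_lim)
  have \<xi>_lim: "((\<lambda>t. \<xi> t l) \<longlongrightarrow> 0) at_top" if "l < n i" for l
    by (rule hurwitz_forced_ode_tendsto_zero[OF G hurwitz \<xi>_deriv g_lim that])
  have err: "track_err C D F (K1 i) (K2 i) (x i t) (\<eta> i t) (v t) $ k
      = (\<Sum>j<n i. (C + D * K1 i) $$ (k, j) * \<xi> t j)
        + (\<Sum>l<q. (D * K2 i) $$ (k, l) * (\<eta> i t $ l - v t $ l))" for t
  proof -
    have "(0\<^sub>m p q *\<^sub>v v t) $ k = 0" using v_dim[of t] k by (simp add: scalar_prod_def)
    then show ?thesis
      using follower_error_split[OF C D F K1 K2 P x_dim \<eta>_dim v_dim k, of t t t]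
      unfolding reg(2) \<xi>_def track_err_def by linarith
  qed
  show ?thesis
    unfolding err
    by (intro tendsto_add_zero tendsto_null_sum tendsto_mult_right_zero)
      (auto intro: \<xi>_lim \<delta>_lim)
qed

text \<open>The observers do not depend on the follower states, so the closed loop is block
  triangular with the state feedback loops and the observer on its diagonal.\<close>

lemma hurwitz_closed_loop_mat:
  assumes A: "\<And>i. i < Nf \<Longrightarrow> A i \<in> carrier_mat (n i) (n i)"
    and B: "\<And>i. i < Nf \<Longrightarrow> B i \<in> carrier_mat (n i) (m i)"
    and K1: "\<And>i. i < Nf \<Longrightarrow> K1 i \<in> carrier_mat (m i) (n i)"
    and K2: "\<And>i. i < Nf \<Longrightarrow> K2 i \<in> carrier_mat (m i) q"
    and followers: "\<And>i. i < Nf \<Longrightarrow> hurwitz (A i + B i * K1 i)"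
    and observer: "hurwitz (obs_mat Nf q S \<mu> (lapH Nf a a0))"
  shows "hurwitz (closed_loop_mat Nf q S \<mu> a a0 A B K1 K2)"
proof -
  let ?Dx = "bdiag (map (\<lambda>i. A i + B i * K1 i) [0..<Nf])"
  let ?Dxe = "bdiag (map (\<lambda>i. B i * K2 i) [0..<Nf])"
  have Dx_dims: "dim_row ?Dx = (\<Sum>i\<leftarrow>[0..<Nf]. n i)" "dim_col ?Dx = (\<Sum>i\<leftarrow>[0..<Nf]. n i)"
    by (auto simp: o_def carrier_matD[OF B] carrier_matD[OF K1] intro!: arg_cong[of _ _ sum_list] map_cong)
  then have Dx: "?Dx \<in> carrier_mat (dim_col ?Dx) (dim_col ?Dx)"
    by (intro carrier_matI) (simp_all del: dim_bdiag)
  have "dim_row ?Dxe = (\<Sum>i\<leftarrow>[0..<Nf]. n i)"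
    by (auto simp: o_def carrier_matD[OF B] intro!: arg_cong[of _ _ sum_list] map_cong)
  moreover have "dim_col ?Dxe = (\<Sum>i\<leftarrow>[0..<Nf]. q)"
    by (auto simp: o_def carrier_matD[OF K2] intro!: arg_cong[of _ _ sum_list] map_cong)
  ultimately have Dxe: "?Dxe \<in> carrier_mat (dim_col ?Dx) (Nf * q)"
    unfolding Dx_dims by (intro carrier_matI) (simp_all del: dim_bdiag add: sum_list_triv)
  have O: "obs_mat Nf q S \<mu> (lapH Nf a a0) \<in> carrier_mat (Nf * q) (Nf * q)"
    by (simp add: obs_mat_def)
  have "hurwitz ?Dx" by (rule hurwitz_bdiag) (auto intro: followers)
  from hurwitz_four_block[OF Dx Dxe O this observer] show ?thesis
    unfolding closed_loop_mat_def Let_def .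
qed

section \<open>Gains computed from data\<close>

lemma state_feedback_from_data:
  fixes M N :: "real mat"
  assumes M: "M \<in> carrier_mat r n" and N: "N \<in> carrier_mat r m"
    and X: "X \<in> carrier_mat n T" and U: "U \<in> carrier_mat m T"
    and Xp: "Xp \<in> carrier_mat T n" and inv: "X * Xp = 1\<^sub>m n"
  shows "(M * X + N * U) * Xp = M + N * (U * Xp)"
proof -
  have "(M * X + N * U) * Xp = M * X * Xp + N * U * Xp"
    using M N X U Xp by (intro add_mult_distrib_mat) auto
  also have "M * X * Xp = M" using assoc_mult_mat[OF M X Xp] M by (simp add: inv)
  also have "N * U * Xp = N * (U * Xp)" by (rule assoc_mult_mat[OF N U Xp])
  finally show ?thesis .
qed

text \<open>The two contributions of \<open>K1\<close> cancel, and what remains is a product of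
  measured data with \<open>Y\<close>. This is why one pair of gains satisfies the regulator
  equations of every consistent system.\<close>

lemma feedforward_from_data:
  fixes M N :: "real mat"
  assumes M: "M \<in> carrier_mat r n" and N: "N \<in> carrier_mat r m"
    and X: "X \<in> carrier_mat n T" and U: "U \<in> carrier_mat m T"
    and Y: "Y \<in> carrier_mat T q" and K1: "K1 \<in> carrier_mat m n"
  shows "(M + N * K1) * (X * Y) + N * (U * Y - K1 * (X * Y)) = (M * X + N * U) * Y"
proof -
  have XY: "X * Y \<in> carrier_mat n q" and UY: "U * Y \<in> carrier_mat m q"
    and NK1: "N * K1 \<in> carrier_mat r n" using X U Y N K1 by auto
  have KXY: "K1 * (X * Y) \<in> carrier_mat m q" using K1 XY by simp
  have a: "(M + N * K1) * (X * Y) = M * (X * Y) + N * (K1 * (X * Y))"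
    unfolding add_mult_distrib_mat[OF M NK1 XY] assoc_mult_mat[OF N K1 XY] ..
  have b: "N * (U * Y - K1 * (X * Y)) = N * (U * Y) - N * (K1 * (X * Y))"
    by (rule mult_minus_distrib_mat[OF N UY KXY])
  have MX: "M * X \<in> carrier_mat r T" and NU: "N * U \<in> carrier_mat r T" using M N X U by auto
  have c: "(M * X + N * U) * Y = M * (X * Y) + N * (U * Y)"
    unfolding add_mult_distrib_mat[OF MX NU Y] assoc_mult_mat[OF M X Y] assoc_mult_mat[OF N U Y] ..
  have add_minus: "P + Q + (R - Q) = P + R"
    if "P \<in> carrier_mat r q" "Q \<in> carrier_mat r q" "R \<in> carrier_mat r q" for P Q R :: "real mat"
    using that by (intro eq_matI) auto
  show ?thesis
    unfolding a b c by (rule add_minus) (use M N XY UY KXY in auto)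
qed

lemma consistent_sysD:
  assumes sys: "consistent_sys n m p X U Ecal V D11 E F A B C D"
    and X: "X \<in> carrier_mat n T" and U: "U \<in> carrier_mat m T"
    and V: "V \<in> carrier_mat q T" and E: "E \<in> carrier_mat n q" and F: "F \<in> carrier_mat p q"
  shows "X * D11 - E * V = A * X + B * U" "Ecal - F * V = C * X + D * U"
proof -
  have add_minus: "P + Q - Q = P"
    if "P \<in> carrier_mat r T" "Q \<in> carrier_mat r T" for P Q :: "real mat" and r
    using that by (intro eq_matI) auto
  have c: "A \<in> carrier_mat n n" "B \<in> carrier_mat n m" "C \<in> carrier_mat p n" "D \<in> carrier_mat p m"
    and eq: "X * D11 = A * X + B * U + E * V" "Ecal = C * X + D * U + F * V"
    using sys by (auto simp: consistent_sys_def)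
  show "X * D11 - E * V = A * X + B * U"
    unfolding eq(1) by (rule add_minus[of _ n]) (use c X U E V in auto)
  show "Ecal - F * V = C * X + D * U"
    unfolding eq(2) by (rule add_minus[of _ p]) (use c X U F V in auto)
qed

theorem theorem4:
  fixes Nf :: nat and n m :: "nat \<Rightarrow> nat" and p q T :: nat
    and X U Ecal E F :: "nat \<Rightarrow> real mat" and V D11 S :: "real mat"
    and eps1 eps2 :: real
  assumes dimX: "\<forall>i<Nf. X i \<in> carrier_mat (n i) T"
    and dimU: "\<forall>i<Nf. U i \<in> carrier_mat (m i) T"
    and dimEcal: "\<forall>i<Nf. Ecal i \<in> carrier_mat p T"
    and dimV: "V \<in> carrier_mat q T"
    and dimD11: "D11 \<in> carrier_mat T T"
    and dimE: "\<forall>i<Nf. E i \<in> carrier_mat (n i) q"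
    and dimF: "\<forall>i<Nf. F i \<in> carrier_mat p q"
    and dimS: "S \<in> carrier_mat q q"
    and S_antistable: "\<forall>z\<in>spec S. 0 \<le> Re z"
    and eps: "0 < eps1" "eps1 \<le> eps2"
    and data_cond: "\<forall>i<Nf. \<exists>Xp. Xp \<in> carrier_mat T (n i) \<and> X i * Xp = 1\<^sub>m (n i) \<and>
                       hurwitz ((X i * D11 - E i * V) * Xp) \<and>
                       (\<forall>z\<in>spec S. vec_space.rank (n i + p) (dd_tz_mat (X i) (Ecal i) V D11 (E i) (F i) z) = n i + p)"
  shows "\<exists>\<mu>0. \<forall>\<mu>\<ge>\<mu>0. coop_informative Nf n m p q X U Ecal V D11 E F S eps1 eps2 \<mu>"
proof -
  obtain \<mu>0 where \<mu>0: "\<And>\<mu> a a0. \<mu>0 \<le> \<mu> \<Longrightarrow> admissible_graph Nf a a0 eps1 eps2 \<Longrightarrow>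
      hurwitz (obs_mat Nf q S \<mu> (lapH Nf a a0))"
    using hurwitz_obs_mat[OF dimS eps] by metis
  have "\<exists>Xp Y. Xp \<in> carrier_mat T (n i) \<and> X i * Xp = 1\<^sub>m (n i) \<and>
      hurwitz ((X i * D11 - E i * V) * Xp) \<and> Y \<in> carrier_mat T q \<and>
      (X i * D11 - E i * V) * Y + E i = X i * Y * S \<and> (Ecal i - F i * V) * Y + F i = 0\<^sub>m p q"
    if i: "i < Nf" for i
  proof -
    from data_cond i obtain Xp where Xp: "Xp \<in> carrier_mat T (n i)" "X i * Xp = 1\<^sub>m (n i)"
        "hurwitz ((X i * D11 - E i * V) * Xp)"
      and rank: "\<forall>z\<in>spec S. vec_space.rank (n i + p) (dd_tz_mat (X i) (Ecal i) V D11 (E i) (F i) z) = n i + p"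
      by blast
    obtain Y where "Y \<in> carrier_mat T q" "(X i * D11 - E i * V) * Y + E i = X i * Y * S"
        "(Ecal i - F i * V) * Y + F i = 0\<^sub>m p q"
      using data_regulator_equations[of "X i" "n i" T "Ecal i" p V q D11 "E i" "F i" S]
        dimX dimEcal dimV dimD11 dimE dimF dimS i rank by blast
    with Xp show ?thesis by blast
  qed
  then obtain Xp Y where XpY: "\<And>i. i < Nf \<Longrightarrow> Xp i \<in> carrier_mat T (n i) \<and> X i * Xp i = 1\<^sub>m (n i) \<and>
      hurwitz ((X i * D11 - E i * V) * Xp i) \<and> Y i \<in> carrier_mat T q \<and>
      (X i * D11 - E i * V) * Y i + E i = X i * Y i * S \<and> (Ecal i - F i * V) * Y i + F i = 0\<^sub>m p q"
    by metis
  have Xp: "Xp i \<in> carrier_mat T (n i)" "X i * Xp i = 1\<^sub>m (n i)"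
      "hurwitz ((X i * D11 - E i * V) * Xp i)"
    and Y: "Y i \<in> carrier_mat T q" "(X i * D11 - E i * V) * Y i + E i = X i * Y i * S"
      "(Ecal i - F i * V) * Y i + F i = 0\<^sub>m p q" if "i < Nf" for i
    using XpY[OF that] by blast+
  \<comment> \<open>The gains are fixed before the graph and the system matrices are introduced: the
    same pair works for all of them.\<close>
  define K1 where "K1 i = U i * Xp i" for i
  define K2 where "K2 i = U i * Y i - K1 i * (X i * Y i)" for i
  have K1: "K1 i \<in> carrier_mat (m i) (n i)" if "i < Nf" for i
    using that dimU Xp(1) by (auto simp: K1_def)
  have K2: "K2 i \<in> carrier_mat (m i) q" if "i < Nf" for i
    unfolding K2_def using K1[OF that] Y(1)[OF that] dimX that
    by (intro minus_carrier_mat) auto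
  have "coop_informative Nf n m p q X U Ecal V D11 E F S eps1 eps2 \<mu>" if \<mu>: "\<mu>0 \<le> \<mu>" for \<mu>
    unfolding coop_informative_def
  proof (intro allI impI, elim conjE)
    fix a a0 A B C D
    assume adm: "admissible_graph Nf a a0 eps1 eps2"
      and sys: "\<forall>i<Nf. consistent_sys (n i) (m i) p (X i) (U i) (Ecal i) V D11 (E i) (F i)
        (A i) (B i) (C i) (D i)"
    note obs = \<mu>0[OF \<mu> adm]
    have A: "A i \<in> carrier_mat (n i) (n i)" and B: "B i \<in> carrier_mat (n i) (m i)"
      and C: "C i \<in> carrier_mat p (n i)" and D: "D i \<in> carrier_mat p (m i)" if "i < Nf" for i
      using sys that unfolding consistent_sys_def by blast+
    have dimX': "X i \<in> carrier_mat (n i) T" and dimU': "U i \<in> carrier_mat (m i) T"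
      and dimE': "E i \<in> carrier_mat (n i) q" and dimF': "F i \<in> carrier_mat p q" if "i < Nf" for i
      using that dimX dimU dimE dimF by blast+
    \<comment> \<open>These identities exchange the unknown system for known data, so the stability
      of the data matrix and the equations for \<open>Y\<close> transfer to any consistent
      system.\<close>
    have data: "X i * D11 - E i * V = A i * X i + B i * U i"
      "Ecal i - F i * V = C i * X i + D i * U i" if i: "i < Nf" for i
      using consistent_sysD[OF sys[rule_format, OF i] dimX'[OF i] dimU'[OF i] dimV dimE'[OF i] dimF'[OF i]]
      by blast+
    have stable: "hurwitz (A i + B i * K1 i)" if i: "i < Nf" for i
      using Xp(3)[OF i]
      unfolding data[OF i] K1_def state_feedback_from_data[OF A[OF i] B[OF i] dimX'[OF i] dimU'[OF i]
          Xp(1)[OF i] Xp(2)[OF i]] .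
    have reg: "(A i + B i * K1 i) * (X i * Y i) + B i * K2 i + E i = X i * Y i * S"
      "(C i + D i * K1 i) * (X i * Y i) + D i * K2 i + F i = 0\<^sub>m p q" if i: "i < Nf" for i
      using Y(2,3)[OF i]
      unfolding data[OF i] K2_def
        feedforward_from_data[OF A[OF i] B[OF i] dimX'[OF i] dimU'[OF i] Y(1)[OF i] K1[OF i]]
        feedforward_from_data[OF C[OF i] D[OF i] dimX'[OF i] dimU'[OF i] Y(1)[OF i] K1[OF i]] .
    have "hurwitz (closed_loop_mat Nf q S \<mu> a a0 A B K1 K2)"
      by (rule hurwitz_closed_loop_mat[OF A B K1 K2 stable obs])
    moreover have "((\<lambda>t. track_err (C i) (D i) (F i) (K1 i) (K2 i) (x i t) (\<eta> i t) (v t) $ k)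
        \<longlongrightarrow> 0) at_top"
      if sol: "cl_solution Nf n q S \<mu> a a0 A B E K1 K2 v x \<eta>" and i: "i < Nf" and k: "k < p"
      for v x \<eta> i k
    proof -
      have P: "X i * Y i \<in> carrier_mat (n i) q" using dimX'[OF i] Y(1)[OF i] by simp
      show ?thesis
        by (rule track_err_tendsto_zero[OF sol dimS obs i A[OF i] B[OF i] C[OF i] D[OF i]
            dimE'[OF i] dimF'[OF i] K1[OF i] K2[OF i] P stable[OF i] reg[OF i] k])
    qed
    ultimately show "\<exists>K1 K2. (\<forall>i<Nf. K1 i \<in> carrier_mat (m i) (n i) \<and> K2 i \<in> carrier_mat (m i) q) \<and>
        hurwitz (closed_loop_mat Nf q S \<mu> a a0 A B K1 K2) \<and>
        (\<forall>v x \<eta>. cl_solution Nf n q S \<mu> a a0 A B E K1 K2 v x \<eta> \<longrightarrow>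
          (\<forall>i<Nf. \<forall>k<p. ((\<lambda>t. track_err (C i) (D i) (F i) (K1 i) (K2 i) (x i t) (\<eta> i t) (v t) $ k)
            \<longlongrightarrow> 0) at_top))"
      using K1 K2 by (intro exI[of _ K1] exI[of _ K2]) blast
  qed
  then show ?thesis by blast
qed

end
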